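(* Suppose $G$ is a linear algebraic group over an algebraically closed field $\Bbbk$ (of arbitrary characteristic) such that $\sigma(G)$ is finite. Then the identity component $G^0$ is unipotent, i.e. either $G$ is finite or $G^0$ is infinite unipotent.
   Context: A $G$-module is a finite-dimensional rational representation $V$ of $G$ over $\Bbbk$. $\Bbbk[V]\cong S(V^* )$ is the ring of polynomial functions on $V$, with $G$-action $(g\cdot f)(v)=f(g^{-1}v)$ and invariant ring $\Bbbk[V]^G$, graded by degree. $\Bbbk[V]^G_{\le d}$ is the set of invariants of degree at most $d$. For $S\subseteq \Bbbk[V]$, $S_+$ is the set of elements of $S$ with constant term zero. The nullcone $\mathcal{N}_{G,V}\subseteq V$ is the common zero set of $\Bbbk[V]^G_+$. A subset $S\subseteq\Bbbk[V]^G$ is a $\sigma$-set if for every $v\in V\setminus\mathcal{N}_{G,V}$ there is $f\in S_+$ with $f(v)\neq 0$. Define $\sigma(G,V)=\min\{d\ge 0 : \Bbbk[V]^G_{\le d}\text{ is a }\sigma\text{-set}\}$ and $\sigma(G)=\sup\{\sigma(G,V): V\text{ a }G\text{-module}\}$ (equal to $\infty$ if unbounded). *)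

theory Defs
  imports
    "HOL-Analysis.Abstract_Topology_2"
    "HOL-Library.Poly_Mapping"
    "HOL-Library.Extended_Nat"
    "HOL-Computational_Algebra.Polynomial"
    "Jordan_Normal_Form.Determinant"
begin

section \<open>Multivariate polynomials\<close>

text \<open>A polynomial is a finitely supported map from exponent vectors to coefficients.\<close>

type_synonym ('x, 'a) mpoly = "('x \<Rightarrow>\<^sub>0 nat) \<Rightarrow>\<^sub>0 'a"

definition polys_in :: "'x set \<Rightarrow> ('x, 'a::zero) mpoly set" where
  "polys_in X = {p. \<forall>\<mu>\<in>Poly_Mapping.keys p. Poly_Mapping.keys \<mu> \<subseteq> X}"

definition monom_eval :: "('x \<Rightarrow>\<^sub>0 nat) \<Rightarrow> ('x \<Rightarrow> 'a) \<Rightarrow> 'a::comm_semiring_1" where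
  "monom_eval \<mu> x = (\<Prod>i\<in>Poly_Mapping.keys \<mu>. x i ^ Poly_Mapping.lookup \<mu> i)"

definition mpoly_eval :: "('x, 'a) mpoly \<Rightarrow> ('x \<Rightarrow> 'a) \<Rightarrow> 'a::comm_semiring_1" where
  "mpoly_eval p x = (\<Sum>\<mu>\<in>Poly_Mapping.keys p. Poly_Mapping.lookup p \<mu> * monom_eval \<mu> x)"

definition monom_degree :: "('x \<Rightarrow>\<^sub>0 nat) \<Rightarrow> nat" where
  "monom_degree \<mu> = (\<Sum>i\<in>Poly_Mapping.keys \<mu>. Poly_Mapping.lookup \<mu> i)"

definition degree_at_most :: "nat \<Rightarrow> ('x, 'a::zero) mpoly set" where
  "degree_at_most d = {p. \<forall>\<mu>\<in>Poly_Mapping.keys p. monom_degree \<mu> \<le> d}"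

definition const_term :: "('x, 'a::zero) mpoly \<Rightarrow> 'a" where
  "const_term p = Poly_Mapping.lookup p 0"

lemma monom_eval_superset:
  assumes "finite A" "Poly_Mapping.keys \<mu> \<subseteq> A"
  shows "monom_eval \<mu> x = (\<Prod>i\<in>A. x i ^ Poly_Mapping.lookup \<mu> i)"
  unfolding monom_eval_def
  by (rule prod.mono_neutral_left) (use assms in \<open>auto simp: in_keys_iff\<close>)

lemma monom_eval_add: "monom_eval (\<mu> + \<nu>) x = monom_eval \<mu> x * monom_eval \<nu> x"
proof -
  let ?A = "Poly_Mapping.keys \<mu> \<union> Poly_Mapping.keys \<nu>"
  have "Poly_Mapping.keys (\<mu> + \<nu>) \<subseteq> ?A" by (rule keys_add)
  then show ?thesis
    by (simp add: monom_eval_superset[of ?A] lookup_add power_add prod.distrib)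
qed

lemma mpoly_eval_superset:
  assumes "finite A" "Poly_Mapping.keys p \<subseteq> A"
  shows "mpoly_eval p x = (\<Sum>\<mu>\<in>A. Poly_Mapping.lookup p \<mu> * monom_eval \<mu> x)"
  unfolding mpoly_eval_def
  by (rule sum.mono_neutral_left) (use assms in \<open>auto simp: in_keys_iff\<close>)

lemma mpoly_eval_zero [simp]: "mpoly_eval 0 x = 0"
  by (simp add: mpoly_eval_def)

lemma mpoly_eval_one [simp]: "mpoly_eval 1 x = 1"
  by (simp add: mpoly_eval_def monom_eval_def lookup_one when_def)

lemma mpoly_eval_add: "mpoly_eval (p + q) x = mpoly_eval p x + mpoly_eval q x"
proof -
  let ?A = "Poly_Mapping.keys p \<union> Poly_Mapping.keys q"
  have "Poly_Mapping.keys (p + q) \<subseteq> ?A" by (rule keys_add)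
  then show ?thesis
    by (simp add: mpoly_eval_superset[of ?A] lookup_add distrib_right sum.distrib)
qed

lemma mpoly_eval_sum: "mpoly_eval (\<Sum>i\<in>I. f i) x = (\<Sum>i\<in>I. mpoly_eval (f i) x)"
  by (induction I rule: infinite_finite_induct) (simp_all add: mpoly_eval_add)

lemma mpoly_eval_single: "mpoly_eval (Poly_Mapping.single \<mu> c) x = c * monom_eval \<mu> x"
  by (simp add: mpoly_eval_def)

lemma mpoly_sum_monomials:
  "p = (\<Sum>\<mu>\<in>Poly_Mapping.keys p. Poly_Mapping.single \<mu> (Poly_Mapping.lookup p \<mu>))"
proof (rule poly_mapping_eqI)
  fix k
  show "Poly_Mapping.lookup p k =
    Poly_Mapping.lookup
      (\<Sum>\<mu>\<in>Poly_Mapping.keys p. Poly_Mapping.single \<mu> (Poly_Mapping.lookup p \<mu>)) k"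
    by (simp add: lookup_sum lookup_single when_def in_keys_iff)
qed

lemma mpoly_eval_mult:
  fixes p q :: "('x, 'a::comm_semiring_1) mpoly"
  shows "mpoly_eval (p * q) x = mpoly_eval p x * mpoly_eval q x"
proof -
  let ?P = "Poly_Mapping.keys p" and ?Q = "Poly_Mapping.keys q"
  have "p * q = (\<Sum>\<mu>\<in>?P. \<Sum>\<nu>\<in>?Q. Poly_Mapping.single (\<mu> + \<nu>)
                   (Poly_Mapping.lookup p \<mu> * Poly_Mapping.lookup q \<nu>))"
    using arg_cong2[of _ _ _ _ "(*)", OF mpoly_sum_monomials[of p] mpoly_sum_monomials[of q]]
    by (simp only: sum_product mult_single)
  then have "mpoly_eval (p * q) x = (\<Sum>\<mu>\<in>?P. \<Sum>\<nu>\<in>?Q.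
      (Poly_Mapping.lookup p \<mu> * Poly_Mapping.lookup q \<nu>) * (monom_eval \<mu> x * monom_eval \<nu> x))"
    by (simp only: mpoly_eval_sum mpoly_eval_single monom_eval_add)
  also have "\<dots> = mpoly_eval p x * mpoly_eval q x"
    unfolding mpoly_eval_def sum_product by (intro sum.cong refl) (simp only: mult_ac)
  finally show ?thesis .
qed

lemma polys_in_mult:
  assumes "p \<in> polys_in X" "q \<in> polys_in X"
  shows "p * q \<in> polys_in X"
  unfolding polys_in_def
proof (intro CollectI ballI)
  fix \<mu> assume "\<mu> \<in> Poly_Mapping.keys (p * q)"
  then obtain a b where ab: "\<mu> = a + b" "a \<in> Poly_Mapping.keys p" "b \<in> Poly_Mapping.keys q"
    using keys_mult[of p q] by blast
  then have "Poly_Mapping.keys \<mu> \<subseteq> Poly_Mapping.keys a \<union> Poly_Mapping.keys b"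
    by (simp only: keys_add)
  then show "Poly_Mapping.keys \<mu> \<subseteq> X"
    using ab assms by (auto simp: polys_in_def)
qed


section \<open>Linear algebraic groups\<close>

abbreviation entry_polys :: "nat \<Rightarrow> (nat \<times> nat, 'a::zero) mpoly set" where
  "entry_polys n \<equiv> polys_in ({..<n} \<times> {..<n})"

definition zariski :: "nat \<Rightarrow> 'a::field mat topology" where
  "zariski n = topology (\<lambda>U. \<exists>P \<subseteq> entry_polys n.
     U = {A \<in> carrier_mat n n. \<exists>p\<in>P. mpoly_eval p (($$) A) \<noteq> 0})"

lemma openin_zariski:
  "openin (zariski n) U \<longleftrightarrow> (\<exists>P \<subseteq> entry_polys n.
     U = {A \<in> carrier_mat n n. \<exists>p\<in>P. mpoly_eval p (($$) A) \<noteq> (0::'a::field)})"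
proof -
  let ?D = "\<lambda>P. {A \<in> carrier_mat n n. \<exists>p\<in>P. mpoly_eval p (($$) A) \<noteq> (0::'a)}"
  have "istopology (\<lambda>U. \<exists>P \<subseteq> entry_polys n. U = ?D P)"
    unfolding istopology_def
  proof (intro conjI allI impI)
    fix S T assume "\<exists>P \<subseteq> entry_polys n. S = ?D P" "\<exists>P \<subseteq> entry_polys n. T = ?D P"
    then obtain P Q where P: "P \<subseteq> entry_polys n" "S = ?D P"
      and Q: "Q \<subseteq> entry_polys n" "T = ?D Q" by blast
    let ?R = "(\<lambda>(p, q). p * q) ` (P \<times> Q)"
    have R: "?R \<subseteq> entry_polys n" using P(1) Q(1) by (auto intro!: polys_in_mult)
    have "(\<exists>r\<in>?R. mpoly_eval r x \<noteq> 0) \<longleftrightarrow>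
        (\<exists>p\<in>P. mpoly_eval p x \<noteq> 0) \<and> (\<exists>q\<in>Q. mpoly_eval q x \<noteq> 0)" for x :: "nat \<times> nat \<Rightarrow> 'a"
      by (simp add: mpoly_eval_mult)
    then have "S \<inter> T = ?D ?R" unfolding P(2) Q(2) by blast
    with R show "\<exists>P \<subseteq> entry_polys n. S \<inter> T = ?D P" by (intro exI[of _ ?R] conjI)
  next
    fix K assume "\<forall>U\<in>K. \<exists>P \<subseteq> entry_polys n. U = ?D P"
    then obtain F where F: "\<forall>U\<in>K. F U \<subseteq> entry_polys n \<and> U = ?D (F U)"
      unfolding bchoice_iff by blast
    have mem: "A \<in> U \<longleftrightarrow> A \<in> ?D (F U)" if "U \<in> K" for A U
      by (rule arg_cong[OF conjunct2[OF bspec[OF F that]]])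
    have "\<Union> K = ?D (\<Union> (F ` K))"
    proof (rule Set.set_eqI)
      fix A
      show "A \<in> \<Union> K \<longleftrightarrow> A \<in> ?D (\<Union> (F ` K))"
        unfolding Union_iff using mem[of _ A] by (simp cong: bex_cong)
    qed
    moreover have "\<Union> (F ` K) \<subseteq> entry_polys n" using F by blast
    ultimately show "\<exists>P \<subseteq> entry_polys n. \<Union> K = ?D P"
      by (intro exI[of _ "\<Union> (F ` K)"] conjI)
  qed
  then show ?thesis by (simp add: zariski_def topology_inverse')
qed

lemma topspace_zariski [simp]: "topspace (zariski n) = (carrier_mat n n :: 'a::field mat set)"
proof
  show "topspace (zariski n) \<subseteq> (carrier_mat n n :: 'a mat set)"
    using openin_topspace[of "zariski n :: 'a mat topology"] unfolding openin_zariski by blast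
  have "(1 :: (nat \<times> nat, 'a) mpoly) \<in> entry_polys n" by (simp add: polys_in_def)
  then have "openin (zariski n) (carrier_mat n n :: 'a mat set)"
    unfolding openin_zariski by (intro exI[of _ "{1}"]) auto
  then show "(carrier_mat n n :: 'a mat set) \<subseteq> topspace (zariski n)" by (rule openin_subset)
qed

lemma closedin_zariski:
  "closedin (zariski n) C \<longleftrightarrow> (\<exists>P \<subseteq> entry_polys n.
     C = {A \<in> carrier_mat n n. \<forall>p\<in>P. mpoly_eval p (($$) A) = (0::'a::field)})"
proof -
  let ?Z = "\<lambda>P. {A \<in> carrier_mat n n. \<forall>p\<in>P. mpoly_eval p (($$) A) = (0::'a)}"
  let ?D = "\<lambda>P. {A \<in> carrier_mat n n. \<exists>p\<in>P. mpoly_eval p (($$) A) \<noteq> (0::'a)}"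
  have "C \<subseteq> carrier_mat n n \<and> carrier_mat n n - C = ?D P \<longleftrightarrow> C = ?Z P" for P
    by blast
  moreover have pull: "(A \<and> (\<exists>P. S P \<and> Q P)) = (\<exists>P. S P \<and> R P)"
    if "\<And>P. (A \<and> Q P) = R P" for A and S Q R :: "'c \<Rightarrow> bool"
    unfolding that[symmetric] by blast
  ultimately show ?thesis
    unfolding closedin_def openin_zariski topspace_zariski by (intro pull)
qed

definition GL :: "nat \<Rightarrow> 'a::field mat monoid" where
  "GL n = units_of (ring_mat TYPE('a) n ())"

definition linear_algebraic_group :: "nat \<Rightarrow> 'a::field mat set \<Rightarrow> bool" where
  "linear_algebraic_group n G \<longleftrightarrow>
     subgroup G (GL n) \<and> closedin (subtopology (zariski n) (carrier (GL n))) G"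

definition identity_component :: "nat \<Rightarrow> 'a::field mat set \<Rightarrow> 'a mat set" where
  "identity_component n G = connected_component_of_set (subtopology (zariski n) G) (1\<^sub>m n)"

definition unipotent :: "nat \<Rightarrow> 'a::field mat set \<Rightarrow> bool" where
  "unipotent n H \<longleftrightarrow> (\<forall>g\<in>H. \<exists>k. (g - 1\<^sub>m n) ^\<^sub>m k = 0\<^sub>m n n)"


section \<open>Rational representations and their invariants\<close>

text \<open>The coordinate ring of \<open>GL n\<close> is generated by the matrix entries and the inverse of the
  determinant, and regular functions on a closed subgroup are restrictions of regular functions
  on \<open>GL n\<close>.\<close>

definition regular_on :: "nat \<Rightarrow> 'a::field mat set \<Rightarrow> ('a mat \<Rightarrow> 'a) \<Rightarrow> bool" where
  "regular_on n G f \<longleftrightarrow>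
     (\<exists>p\<in>entry_polys n. \<exists>e::nat. \<forall>g\<in>G. f g = mpoly_eval p (($$) g) / det g ^ e)"

text \<open>A \<open>G\<close>-module of dimension \<open>m\<close>, in coordinates: the underlying space is
  \<open>carrier_vec m\<close>.\<close>

definition rational_rep :: "nat \<Rightarrow> 'a::field mat set \<Rightarrow> nat \<Rightarrow> ('a mat \<Rightarrow> 'a mat) \<Rightarrow> bool" where
  "rational_rep n G m \<rho> \<longleftrightarrow>
     \<rho> \<in> hom ((GL n)\<lparr>carrier := G\<rparr>) (GL m) \<and>
     (\<forall>i<m. \<forall>j<m. regular_on n G (\<lambda>g. \<rho> g $$ (i, j)))"

text \<open>Over an infinite field a polynomial is determined by its values, so the condition below,
  that \<open>g \<cdot> f\<close> and \<open>f\<close> agree as functions on the module, says \<open>g \<cdot> f = f\<close>.\<close>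

definition invariants :: "nat \<Rightarrow> 'a::field mat set \<Rightarrow> nat \<Rightarrow> ('a mat \<Rightarrow> 'a mat) \<Rightarrow> (nat, 'a) mpoly set"
  where "invariants n G m \<rho> = {f \<in> polys_in {..<m}. \<forall>g\<in>G. \<forall>v\<in>carrier_vec m.
           mpoly_eval f (($) (\<rho> (inv\<^bsub>GL n\<^esub> g) *\<^sub>v v)) = mpoly_eval f (($) v)}"

definition plus_part :: "(nat, 'a::field) mpoly set \<Rightarrow> (nat, 'a) mpoly set" where
  "plus_part S = {f \<in> S. const_term f = 0}"

definition nullcone :: "nat \<Rightarrow> 'a::field mat set \<Rightarrow> nat \<Rightarrow> ('a mat \<Rightarrow> 'a mat) \<Rightarrow> 'a vec set" where
  "nullcone n G m \<rho> =
     {v \<in> carrier_vec m. \<forall>f\<in>plus_part (invariants n G m \<rho>). mpoly_eval f (($) v) = 0}"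

definition sigma_set ::
  "nat \<Rightarrow> 'a::field mat set \<Rightarrow> nat \<Rightarrow> ('a mat \<Rightarrow> 'a mat) \<Rightarrow> (nat, 'a) mpoly set \<Rightarrow> bool" where
  "sigma_set n G m \<rho> S \<longleftrightarrow> S \<subseteq> invariants n G m \<rho> \<and>
     (\<forall>v\<in>carrier_vec m - nullcone n G m \<rho>. \<exists>f\<in>plus_part S. mpoly_eval f (($) v) \<noteq> 0)"

text \<open>The infimum is a minimum: the common zero sets of the invariants of degree at most
  \<open>d\<close> with zero constant term decrease to the nullcone, hence stabilise by Noetherianity.\<close>

definition sigma_rep :: "nat \<Rightarrow> 'a::field mat set \<Rightarrow> nat \<Rightarrow> ('a mat \<Rightarrow> 'a mat) \<Rightarrow> enat" where
  "sigma_rep n G m \<rho> =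
     Inf {enat d | d. sigma_set n G m \<rho> (invariants n G m \<rho> \<inter> degree_at_most d)}"

definition sigma_group :: "nat \<Rightarrow> 'a::field mat set \<Rightarrow> enat" where
  "sigma_group n G = Sup {sigma_rep n G m \<rho> | m \<rho>. rational_rep n G m \<rho>}"

end

theory Submission
  imports Defs "HOL-Library.Product_Lexorder" "Jordan_Normal_Form.Char_Poly"
begin

text \<open>If an element \<open>s\<close> of \<open>G\<close> has an eigenvalue \<open>a\<close> whose order exceeds \<open>(d - 1) * d\<close>, take an
  eigenvector \<open>u\<close> and a generalized left eigenvector \<open>l\<close> for \<open>a\<close> with \<open>l u \<noteq> 0\<close>. On
  \<open>V \<oplus> (V\<^sup>* \<otimes> \<dots> \<otimes> V\<^sup>*)\<close>, with \<open>V\<close> the natural module and \<open>d\<close> tensor factors, the point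
  \<open>(u, l \<otimes> \<dots> \<otimes> l)\<close> is not in the nullcone, since the pairing of \<open>u \<otimes> \<dots> \<otimes> u\<close> with the tensor
  component takes the value \<open>(l u) ^ d\<close> there. On the other hand \<open>s\<close> acts on the two components with
  (generalized) weights \<open>a\<close> and \<open>a\<close> to the power \<open>-d\<close>, so a nonconstant monomial of degree less than \<open>d\<close>
  has a weight different from one there, and invariants of positive degree less than \<open>d\<close> vanish. Hence a
  finite sigma number bounds the orders of all eigenvalues of elements of \<open>G\<close>. Then the
  characteristic polynomial takes only finitely many values on the identity component, so it is
  constant there by connectedness, equal to \<open>(X - 1) ^ n\<close>, and Cayley-Hamilton gives
  unipotency. The identity component of an infinite \<open>G\<close> is infinite because, by
  Noetherianity, \<open>G\<close> is a finite union of connected sets.\<close>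

section \<open>Noetherianity\<close>

lemma nat_seq_incseq_subseq:
  fixes s :: "nat \<Rightarrow> nat"
  shows "\<exists>f. strict_mono f \<and> incseq (s \<circ> f)"
proof -
  obtain f where f: "strict_mono f" "monoseq (\<lambda>n. s (f n))"
    using seq_monosub by blast
  show ?thesis
  proof (cases "incseq (s \<circ> f)")
    case False
    then have dec: "s (f n) \<le> s (f m)" if "m \<le> n" for m n
      using f(2) that by (auto simp: monoseq_def incseq_def)
    define v where "v = (LEAST y. y \<in> range (s \<circ> f))"
    have "v \<in> range (s \<circ> f)" unfolding v_def by (rule LeastI[of _ "s (f 0)"]) auto
    then obtain N where N: "v = s (f N)" by auto
    have v: "v \<le> s (f n)" for n unfolding v_def by (rule Least_le) auto
    have "s (f (N + n)) = v" for n using dec[of N "N + n"] v[of "N + n"] N by simp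
    then have "incseq (s \<circ> (\<lambda>n. f (N + n)))" by (simp add: incseq_def)
    moreover have "strict_mono (\<lambda>n. f (N + n))" using f(1) by (simp add: strict_mono_def)
    ultimately show ?thesis by blast
  qed (use f in blast)
qed

lemma dickson:
  fixes s :: "nat \<Rightarrow> 'x \<Rightarrow> nat"
  assumes "finite X"
  shows "\<exists>f. strict_mono f \<and> (\<forall>i\<in>X. incseq (\<lambda>n. s (f n) i))"
  using assms
proof (induction X rule: finite_induct)
  case empty
  show ?case by (auto intro: exI[of _ id] simp: strict_mono_def)
next
  case (insert x X)
  then obtain f where f: "strict_mono f" "\<forall>i\<in>X. incseq (\<lambda>n. s (f n) i)" by blast
  obtain g where g: "strict_mono g" "incseq ((\<lambda>n. s (f n) x) \<circ> g)"
    using nat_seq_incseq_subseq by blast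
  have "incseq (\<lambda>n. s (f (g n)) i)" if "i \<in> insert x X" for i
  proof (cases "i = x")
    case True
    then show ?thesis using g(2) by (simp add: comp_def)
  next
    case False
    then have "incseq (\<lambda>n. s (f n) i)" using f(2) that by blast
    then show ?thesis using strict_mono_mono[OF g(1)] by (simp add: incseq_def mono_def)
  qed
  moreover have "strict_mono (f \<circ> g)" using f(1) g(1) by (simp add: strict_mono_o)
  ultimately show ?case by (intro exI[of _ "f \<circ> g"]) (simp add: comp_def)
qed

lemma monom_diff:
  fixes \<mu> \<nu> :: "'x \<Rightarrow>\<^sub>0 nat"
  assumes "Poly_Mapping.keys \<nu> \<subseteq> X" "Poly_Mapping.keys \<mu> \<subseteq> X"
    and "\<And>i. i \<in> X \<Longrightarrow> Poly_Mapping.lookup \<mu> i \<le> Poly_Mapping.lookup \<nu> i"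
  shows "\<nu> = \<mu> + (\<nu> - \<mu>)" "Poly_Mapping.keys (\<nu> - \<mu>) \<subseteq> X"
proof -
  have le: "Poly_Mapping.lookup \<mu> i \<le> Poly_Mapping.lookup \<nu> i" for i
  proof (cases "i \<in> X")
    case False
    then have "Poly_Mapping.lookup \<mu> i = 0" using assms(2) by (auto simp: in_keys_iff)
    then show ?thesis by simp
  qed (use assms(3) in blast)
  show "\<nu> = \<mu> + (\<nu> - \<mu>)"
    by (rule poly_mapping_eqI) (simp add: lookup_add lookup_minus le)
  show "Poly_Mapping.keys (\<nu> - \<mu>) \<subseteq> X"
    using assms(1) by (auto simp: in_keys_iff lookup_minus subset_iff)
qed

lemma monom_nonneg: "0 \<le> (\<mu> :: 'x::linorder \<Rightarrow>\<^sub>0 nat)"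
proof (rule ccontr)
  assume "\<not> 0 \<le> \<mu>"
  then have "\<mu> < 0" by simp
  then have "less_fun (Poly_Mapping.lookup \<mu>) (Poly_Mapping.lookup 0)"
    by transfer simp
  then show False by (auto simp: less_fun_def)
qed

lemma monom_le_add: "\<mu> \<le> \<mu> + (\<delta> :: 'x::linorder \<Rightarrow>\<^sub>0 nat)"
  using add_left_mono[OF monom_nonneg[of \<delta>], of \<mu>] by simp

lemma monom_seq_le:
  fixes s :: "nat \<Rightarrow> 'x::linorder \<Rightarrow>\<^sub>0 nat"
  assumes "finite X" "\<And>n. Poly_Mapping.keys (s n) \<subseteq> X"
  obtains i j \<delta> where "i < j" "s j = s i + \<delta>" "Poly_Mapping.keys \<delta> \<subseteq> X"
proof -
  obtain f where f: "strict_mono f" "\<forall>i\<in>X. incseq (\<lambda>n. Poly_Mapping.lookup (s (f n)) i)"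
    using dickson[OF assms(1), of "\<lambda>n. Poly_Mapping.lookup (s n)"] by blast
  have "Poly_Mapping.lookup (s (f 0)) i \<le> Poly_Mapping.lookup (s (f 1)) i" if "i \<in> X" for i
    using f(2) that by (auto simp: incseq_def)
  from monom_diff[OF assms(2) assms(2) this] that[of "f 0" "f 1" "s (f 1) - s (f 0)"] f(1)
  show thesis by (simp add: strict_mono_def)
qed

lemma wf_monom:
  fixes X :: "'x::linorder set"
  assumes "finite X"
  shows "wf {(\<mu> :: 'x \<Rightarrow>\<^sub>0 nat, \<nu>). \<mu> < \<nu> \<and> Poly_Mapping.keys \<mu> \<subseteq> X \<and> Poly_Mapping.keys \<nu> \<subseteq> X}"
  unfolding wf_iff_no_infinite_down_chain
proof
  assume "\<exists>s. \<forall>i. (s (Suc i), s i) \<in>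
    {(\<mu> :: 'x \<Rightarrow>\<^sub>0 nat, \<nu>). \<mu> < \<nu> \<and> Poly_Mapping.keys \<mu> \<subseteq> X \<and> Poly_Mapping.keys \<nu> \<subseteq> X}"
  then obtain s :: "nat \<Rightarrow> 'x \<Rightarrow>\<^sub>0 nat"
    where s: "\<And>i. s (Suc i) < s i" "\<And>i. Poly_Mapping.keys (s i) \<subseteq> X" by blast
  obtain i j \<delta> where ij: "i < j" "s j = s i + \<delta>"
    using monom_seq_le[of X s, OF assms s(2)] by metis
  have "s j < s i" using ij(1)
    by (induction rule: less_Suc_induct) (use s(1) in auto)
  then show False using monom_le_add[of "s i" \<delta>] ij(2) by simp
qed

lemma lookup_single_times:
  fixes q :: "('x, 'a::comm_semiring_1) mpoly"
  shows "Poly_Mapping.lookup (Poly_Mapping.single \<delta> c * q) k =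
    (\<Sum>\<kappa>\<in>Poly_Mapping.keys q. c * Poly_Mapping.lookup q \<kappa> when \<delta> + \<kappa> = k)"
proof -
  have "Poly_Mapping.single \<delta> c * q =
    (\<Sum>\<kappa>\<in>Poly_Mapping.keys q. Poly_Mapping.single (\<delta> + \<kappa>) (c * Poly_Mapping.lookup q \<kappa>))"
    by (subst mpoly_sum_monomials[of q]) (simp add: sum_distrib_left mult_single)
  then show ?thesis by (simp add: lookup_sum lookup_single)
qed

text \<open>The elements whose leading monomials are the minimal ones with respect to divisibility
  suffice: division by them reduces every element to zero.\<close>

lemma hilbert_basis_zeros:
  fixes I :: "('x::linorder, 'a::field) mpoly set"
  assumes X: "finite X" and I: "I \<subseteq> polys_in X"
    and closed: "\<And>p q \<delta> c. p \<in> I \<Longrightarrow> q \<in> I \<Longrightarrow> Poly_Mapping.keys \<delta> \<subseteq> X \<Longrightarrow>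
      p - Poly_Mapping.single \<delta> c * q \<in> I"
  obtains F where "finite F" "F \<subseteq> I"
    "\<And>x. (\<And>f. f \<in> F \<Longrightarrow> mpoly_eval f x = 0) \<Longrightarrow> (\<And>p. p \<in> I \<Longrightarrow> mpoly_eval p x = 0)"
proof -
  let ?lm = "\<lambda>p :: ('x, 'a) mpoly. Max (Poly_Mapping.keys p)"
  let ?R = "{(\<mu> :: 'x \<Rightarrow>\<^sub>0 nat, \<nu>). \<mu> < \<nu> \<and> Poly_Mapping.keys \<mu> \<subseteq> X \<and> Poly_Mapping.keys \<nu> \<subseteq> X}"
  define L where "L = ?lm ` (I - {0})"
  define B where "B = {\<nu>\<in>L. \<forall>\<mu>\<in>L. \<forall>\<delta>. Poly_Mapping.keys \<delta> \<subseteq> X \<longrightarrow> \<nu> = \<mu> + \<delta> \<longrightarrow> \<mu> = \<nu>}"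
  have lm_in: "?lm p \<in> Poly_Mapping.keys p" if "p \<noteq> 0" for p
    using that by simp
  have lm_X: "Poly_Mapping.keys (?lm p) \<subseteq> X" if "p \<in> I" "p \<noteq> 0" for p
    using lm_in[OF that(2)] I that(1) by (auto simp: polys_in_def)
  then have L_X: "Poly_Mapping.keys \<nu> \<subseteq> X" if "\<nu> \<in> L" for \<nu>
    using that by (auto simp: L_def)
  have "finite B"
  proof (rule ccontr)
    assume "infinite B"
    then obtain s :: "nat \<Rightarrow> 'x \<Rightarrow>\<^sub>0 nat" where s: "inj s" "range s \<subseteq> B"
      using infinite_countable_subset by blast
    have sB: "s i \<in> B" for i using s(2) by blast
    then have sX: "Poly_Mapping.keys (s i) \<subseteq> X" for i using L_X by (auto simp: B_def)
    obtain i j \<delta> where ij: "i < j" "s j = s i + \<delta>" "Poly_Mapping.keys \<delta> \<subseteq> X"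
      using monom_seq_le[of X s, OF X sX] by metis
    have "s i = s j" using sB[of i] sB[of j] ij(2,3) by (auto simp: B_def)
    then show False using s(1) ij(1) by (auto dest: injD)
  qed
  have below: "\<exists>b\<in>B. \<exists>\<delta>. Poly_Mapping.keys \<delta> \<subseteq> X \<and> \<nu> = b + \<delta>" if "\<nu> \<in> L" for \<nu>
    using that
  proof (induction \<nu> rule: wf_induct_rule[OF wf_monom[OF X]])
    case (1 \<nu>)
    show ?case
    proof (cases "\<nu> \<in> B")
      case True
      then show ?thesis by (intro bexI[of _ \<nu>] exI[of _ 0]) auto
    next
      case False
      then obtain \<mu> \<delta> where \<mu>: "\<mu> \<in> L" "Poly_Mapping.keys \<delta> \<subseteq> X" "\<nu> = \<mu> + \<delta>" "\<mu> \<noteq> \<nu>"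
        using 1(2) by (auto simp: B_def)
      have "\<mu> < \<nu>" unfolding less_le using \<mu>(3,4) monom_le_add[of \<mu> \<delta>] by simp
      then obtain b \<delta>' where b: "b \<in> B" "Poly_Mapping.keys \<delta>' \<subseteq> X" "\<mu> = b + \<delta>'"
        using 1(1)[of \<mu>] \<mu>(1) L_X[OF 1(2)] L_X[OF \<mu>(1)] by auto
      have "Poly_Mapping.keys (\<delta>' + \<delta>) \<subseteq> X" using b(2) \<mu>(2) keys_add[of \<delta>' \<delta>] by blast
      then show ?thesis using b \<mu>(3) by (intro bexI[of _ b] exI[of _ "\<delta>' + \<delta>"]) (simp_all add: add.assoc)
    qed
  qed
  have "\<forall>b\<in>B. \<exists>g. g \<in> I \<and> g \<noteq> 0 \<and> ?lm g = b" by (auto simp: B_def L_def)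
  then obtain g where g: "\<And>b. b \<in> B \<Longrightarrow> g b \<in> I \<and> g b \<noteq> 0 \<and> ?lm (g b) = b" by metis
  have vanish: "mpoly_eval p x = 0" if gx: "\<And>f. f \<in> g ` B \<Longrightarrow> mpoly_eval f x = 0" and "p \<in> I" for p x
  proof (cases "p = 0")
    case False
    then show ?thesis using \<open>p \<in> I\<close>
    proof (induction "?lm p" arbitrary: p rule: wf_induct_rule[OF wf_monom[OF X]])
      case 1
      let ?\<nu> = "?lm p"
      have "?\<nu> \<in> L" using 1(2,3) by (auto simp: L_def)
      then obtain b \<delta> where b: "b \<in> B" "Poly_Mapping.keys \<delta> \<subseteq> X" "?\<nu> = b + \<delta>" using below by blast
      define q where "q = g b"
      have q: "q \<in> I" "q \<noteq> 0" "?lm q = b" using g[OF b(1)] by (simp_all add: q_def)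
      define c where "c = Poly_Mapping.lookup p ?\<nu> / Poly_Mapping.lookup q b"
      have qb: "Poly_Mapping.lookup q b \<noteq> 0" using lm_in[OF q(2)] q(3) by (simp add: in_keys_iff)
      define p' where "p' = p - Poly_Mapping.single \<delta> c * q"
      have p'I: "p' \<in> I" unfolding p'_def by (rule closed[OF 1(3) q(1) b(2)])
      have p: "p = p' + Poly_Mapping.single \<delta> c * q" by (simp add: p'_def)
      have low: "k < ?\<nu>" if k: "k \<in> Poly_Mapping.keys p'" for k
      proof (rule ccontr)
        assume "\<not> k < ?\<nu>"
        then consider "k = ?\<nu>" | "k > ?\<nu>" by force
        then have "Poly_Mapping.lookup p' k = 0"
        proof cases
          case 1
          have "Poly_Mapping.lookup (Poly_Mapping.single \<delta> c * q) k =
            (\<Sum>\<kappa>\<in>Poly_Mapping.keys q. if \<kappa> = b then c * Poly_Mapping.lookup q b else 0)"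
            unfolding lookup_single_times 1 b(3) add.commute[of b \<delta>]
            by (intro sum.cong refl) (auto simp: when_def)
          also have "\<dots> = c * Poly_Mapping.lookup q b"
            using qb by (simp add: in_keys_iff)
          also have "\<dots> = Poly_Mapping.lookup p k" using qb 1 by (simp add: c_def)
          finally show ?thesis by (simp add: p'_def lookup_minus)
        next
          case 2
          have "\<delta> + \<kappa> < k" if "\<kappa> \<in> Poly_Mapping.keys q" for \<kappa>
          proof -
            have "\<kappa> \<le> b" using that q(3) by auto
            then have "\<delta> + \<kappa> \<le> ?\<nu>" unfolding b(3) by (simp add: add.commute add_left_mono)
            then show ?thesis using 2 by simp
          qed
          then have "Poly_Mapping.lookup (Poly_Mapping.single \<delta> c * q) k = 0"
            unfolding lookup_single_times by (intro sum.neutral) (auto simp: when_def)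
          moreover have "k \<notin> Poly_Mapping.keys p" using 2 Max_ge[OF finite_keys, of k p] leD by blast
          ultimately show ?thesis by (simp add: p'_def lookup_minus in_keys_iff)
        qed
        then show False using k by (simp add: in_keys_iff)
      qed
      have "mpoly_eval p' x = 0"
      proof (cases "p' = 0")
        case False
        then have "?lm p' < ?\<nu>" using low lm_in by blast
        then show ?thesis using 1(1)[of p'] False p'I lm_X[OF p'I False] lm_X[OF 1(3,2)] by blast
      qed simp
      moreover have "mpoly_eval q x = 0" using gx b(1) by (auto simp: q_def)
      ultimately show ?case by (subst p) (simp add: mpoly_eval_add mpoly_eval_mult)
    qed
  qed simp
  show thesis
    by (rule that[of "g ` B"]) (use \<open>finite B\<close> g vanish in auto)
qed

section \<open>Polynomial functions and the Zariski topology\<close>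

definition polyfun :: "nat \<Rightarrow> ('a::field mat \<Rightarrow> 'a) \<Rightarrow> bool" where
  "polyfun n f \<longleftrightarrow> (\<exists>p\<in>entry_polys n. \<forall>A\<in>carrier_mat n n. f A = mpoly_eval p (($$) A))"

lemma polys_in_add: "p \<in> polys_in X \<Longrightarrow> q \<in> polys_in X \<Longrightarrow> p + q \<in> polys_in X"
  using keys_add[of p q] by (auto simp: polys_in_def)

lemma polys_in_diff:
  fixes p q :: "('x, 'a::ab_group_add) mpoly"
  shows "p \<in> polys_in X \<Longrightarrow> q \<in> polys_in X \<Longrightarrow> p - q \<in> polys_in X"
  using keys_diff[of p q] by (auto simp: polys_in_def)

lemma polys_in_single: "Poly_Mapping.keys \<mu> \<subseteq> X \<Longrightarrow> Poly_Mapping.single \<mu> c \<in> polys_in X"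
  by (auto simp: polys_in_def)

lemma monom_eval_0 [simp]: "monom_eval 0 x = 1"
  by (simp add: monom_eval_def)

lemma polyfun_cong:
  "(\<And>A. A \<in> carrier_mat n n \<Longrightarrow> f A = g A) \<Longrightarrow> polyfun n f = polyfun n g"
  by (simp add: polyfun_def)

lemma polyfun_const: "polyfun n (\<lambda>A. c)"
  unfolding polyfun_def
  by (rule bexI[of _ "Poly_Mapping.single 0 c"]) (simp_all add: mpoly_eval_single polys_in_single)

lemma polyfun_entry:
  assumes "i < n" "j < n"
  shows "polyfun n (\<lambda>A. A $$ (i, j))"
  unfolding polyfun_def
  by (rule bexI[of _ "Poly_Mapping.single (Poly_Mapping.single (i, j) 1) 1"])
    (use assms in \<open>simp_all add: mpoly_eval_single polys_in_single monom_eval_def\<close>)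

lemma polyfun_add:
  assumes "polyfun n f" "polyfun n g"
  shows "polyfun n (\<lambda>A. f A + g A)"
proof -
  obtain p q where "p \<in> entry_polys n" "\<forall>A\<in>carrier_mat n n. f A = mpoly_eval p (($$) A)"
    "q \<in> entry_polys n" "\<forall>A\<in>carrier_mat n n. g A = mpoly_eval q (($$) A)"
    using assms unfolding polyfun_def by blast
  then show ?thesis unfolding polyfun_def
    by (intro bexI[of _ "p + q"]) (simp_all add: mpoly_eval_add polys_in_add)
qed

lemma polyfun_mult:
  assumes "polyfun n f" "polyfun n g"
  shows "polyfun n (\<lambda>A. f A * g A)"
proof -
  obtain p q where "p \<in> entry_polys n" "\<forall>A\<in>carrier_mat n n. f A = mpoly_eval p (($$) A)"
    "q \<in> entry_polys n" "\<forall>A\<in>carrier_mat n n. g A = mpoly_eval q (($$) A)"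
    using assms unfolding polyfun_def by blast
  then show ?thesis unfolding polyfun_def
    by (intro bexI[of _ "p * q"]) (simp_all add: mpoly_eval_mult polys_in_mult)
qed

lemma polyfun_diff: "polyfun n f \<Longrightarrow> polyfun n g \<Longrightarrow> polyfun n (\<lambda>A. f A - g A)"
  using polyfun_add[of n f "\<lambda>A. -1 * g A"] polyfun_mult[OF polyfun_const[of n "-1"], of g] by simp

lemma polyfun_sum:
  "(\<And>i. i \<in> I \<Longrightarrow> polyfun n (f i)) \<Longrightarrow> polyfun n (\<lambda>A. \<Sum>i\<in>I. f i A)"
  by (induction I rule: infinite_finite_induct) (simp_all add: polyfun_const polyfun_add)

lemma polyfun_prod:
  "(\<And>i. i \<in> I \<Longrightarrow> polyfun n (f i)) \<Longrightarrow> polyfun n (\<lambda>A. \<Prod>i\<in>I. f i A)"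
  by (induction I rule: infinite_finite_induct) (simp_all add: polyfun_const polyfun_mult)

lemma polyfun_power: "polyfun n f \<Longrightarrow> polyfun n (\<lambda>A. f A ^ k)"
  by (induction k) (simp_all add: polyfun_const polyfun_mult)

lemma polyfun_mpoly_eval:
  assumes "q \<in> polys_in X" "\<And>x. x \<in> X \<Longrightarrow> polyfun n (h x)"
  shows "polyfun n (\<lambda>A. mpoly_eval q (\<lambda>x. h x A))"
  unfolding mpoly_eval_def monom_eval_def using assms(1)
  by (intro polyfun_sum polyfun_mult polyfun_const polyfun_prod polyfun_power assms(2))
    (auto simp: polys_in_def)

lemma polyfun_det:
  assumes "\<And>A. A \<in> carrier_mat n n \<Longrightarrow> M A \<in> carrier_mat m m"
    and "\<And>i j. i < m \<Longrightarrow> j < m \<Longrightarrow> polyfun n (\<lambda>A. M A $$ (i, j))"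
  shows "polyfun n (\<lambda>A. det (M A))"
proof -
  have "polyfun n (\<lambda>A. \<Sum>p | p permutes {0..<m}. signof p * (\<Prod>i = 0..<m. M A $$ (i, p i)))"
    by (intro polyfun_sum polyfun_mult polyfun_const polyfun_prod assms(2))
      (auto simp: permutes_in_image[of _ "{0..<m}", simplified])
  then show ?thesis
    by (subst polyfun_cong) (simp_all add: assms(1) det_def'[of _ m])
qed

lemma index_mult_mat_sum:
  assumes "A \<in> carrier_mat n m" "B \<in> carrier_mat m l" "i < n" "j < l"
  shows "(A * B) $$ (i, j) = (\<Sum>k<m. A $$ (i, k) * B $$ (k, j))"
  using assms by (simp add: scalar_prod_def atLeast0LessThan)

lemma polyfun_times_left:
  assumes g: "g \<in> carrier_mat n n" and f: "polyfun n f"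
  shows "polyfun n (\<lambda>A. f (g * A))"
proof -
  obtain p where p: "p \<in> entry_polys n" "\<forall>A\<in>carrier_mat n n. f A = mpoly_eval p (($$) A)"
    using f by (auto simp: polyfun_def)
  have "polyfun n (\<lambda>A. (g * A) $$ x)" if x: "x \<in> {..<n} \<times> {..<n}" for x
  proof -
    obtain i j where ij: "x = (i, j)" "i < n" "j < n" using x by auto
    have "polyfun n (\<lambda>A. \<Sum>k<n. g $$ (i, k) * A $$ (k, j))"
      using ij by (intro polyfun_sum polyfun_mult polyfun_const polyfun_entry) auto
    then show ?thesis
      by (subst polyfun_cong) (use ij g in \<open>simp_all del: index_mult_mat add: index_mult_mat_sum[of g n n _ n]\<close>)
  qed
  from polyfun_mpoly_eval[OF p(1) this] show ?thesis
    by (subst polyfun_cong) (use p(2) g in simp_all)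
qed

lemma closedin_polyfun_zeros:
  assumes "\<And>f. f \<in> F \<Longrightarrow> polyfun n f"
  shows "closedin (zariski n) {A \<in> carrier_mat n n. \<forall>f\<in>F. f A = 0}"
proof -
  obtain P where P: "\<And>f. f \<in> F \<Longrightarrow> P f \<in> entry_polys n"
    "\<And>f A. f \<in> F \<Longrightarrow> A \<in> carrier_mat n n \<Longrightarrow> f A = mpoly_eval (P f) (($$) A)"
    using assms unfolding polyfun_def by metis
  have "{A \<in> carrier_mat n n. \<forall>f\<in>F. f A = 0} =
      {A \<in> carrier_mat n n. \<forall>p\<in>P ` F. mpoly_eval p (($$) A) = 0}"
    using P(2) by auto
  then show ?thesis
    unfolding closedin_zariski using P(1) by (intro exI[of _ "P ` F"]) auto
qed

lemma closedin_polyfun_eq: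
  assumes "polyfun n f"
  shows "closedin (zariski n) {A \<in> carrier_mat n n. f A = 0}"
  using closedin_polyfun_zeros[of "{f}" n] assms by simp

lemma continuous_map_times_left:
  fixes g :: "'a::field mat"
  assumes g: "g \<in> carrier_mat n n"
  shows "continuous_map (zariski n) (zariski n) (\<lambda>A. g * A)"
  unfolding continuous_map_closedin
proof (intro conjI allI impI)
  fix C :: "'a mat set" assume "closedin (zariski n) C"
  then obtain P where P: "P \<subseteq> entry_polys n"
    "C = {A \<in> carrier_mat n n. \<forall>p\<in>P. mpoly_eval p (($$) A) = 0}"
    unfolding closedin_zariski by blast
  have "{A \<in> topspace (zariski n). g * A \<in> C} =
      {A \<in> carrier_mat n n. \<forall>f\<in>(\<lambda>p A. mpoly_eval p (($$) (g * A))) ` P. f A = 0}"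
    using g unfolding P(2) by auto
  moreover have "closedin (zariski n) \<dots>"
  proof (rule closedin_polyfun_zeros)
    fix f assume "f \<in> (\<lambda>p A. mpoly_eval p (($$) (g * A))) ` P"
    then obtain p where p: "p \<in> P" "f = (\<lambda>A. mpoly_eval p (($$) (g * A)))" by auto
    have "polyfun n (\<lambda>A. mpoly_eval p (($$) A))" using p P(1) by (auto simp: polyfun_def)
    then show "polyfun n f" unfolding p(2) by (rule polyfun_times_left[OF g])
  qed
  ultimately show "closedin (zariski n) {A \<in> topspace (zariski n). g * A \<in> C}" by simp
qed (use g in auto)

lemma wf_zariski_closed:
  fixes S :: "'a::field mat set" and n :: nat
  defines "T \<equiv> subtopology (zariski n) S"
  shows "wf {(C, D). closedin T C \<and> closedin T D \<and> C \<subset> D}"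
  unfolding wf_iff_no_infinite_down_chain
proof
  assume "\<exists>C. \<forall>i. (C (Suc i), C i) \<in> {(C, D). closedin T C \<and> closedin T D \<and> C \<subset> D}"
  then obtain C where "\<And>i. (C (Suc i), C i) \<in> {(C, D). closedin T C \<and> closedin T D \<and> C \<subset> D}"
    by blast
  then have C: "\<And>i. closedin T (C i)" "\<And>i. C (Suc i) \<subset> C i" by simp_all
  have anti: "C j \<subseteq> C i" if "i \<le> j" for i j
    using that by (rule lift_Suc_antimono_le[rotated]) (use C(2) in blast)
  define I where "I = {p \<in> entry_polys n. \<exists>i. \<forall>A\<in>C i. mpoly_eval p (($$) A) = (0::'a)}"
  have closed: "p - Poly_Mapping.single \<delta> c * q \<in> I"
    if pq: "p \<in> I" "q \<in> I" and \<delta>: "Poly_Mapping.keys \<delta> \<subseteq> {..<n} \<times> {..<n}" for p q \<delta> c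
  proof -
    obtain i j where ij: "\<forall>A\<in>C i. mpoly_eval p (($$) A) = 0" "\<forall>A\<in>C j. mpoly_eval q (($$) A) = 0"
      using pq by (auto simp: I_def)
    define r where "r = p - Poly_Mapping.single \<delta> c * q"
    have p: "p = r + Poly_Mapping.single \<delta> c * q" by (simp add: r_def)
    have "mpoly_eval r (($$) A) = 0" if A: "A \<in> C (max i j)" for A
    proof -
      have "A \<in> C i" "A \<in> C j" using A anti[of i "max i j"] anti[of j "max i j"] by auto
      then have "mpoly_eval p (($$) A) = 0" "mpoly_eval q (($$) A) = 0" using ij by auto
      then show ?thesis by (subst (asm) p) (simp add: mpoly_eval_add mpoly_eval_mult)
    qed
    moreover have "r \<in> entry_polys n"
      unfolding r_def using pq \<delta> by (intro polys_in_diff polys_in_mult polys_in_single) (auto simp: I_def)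
    ultimately show ?thesis by (auto simp: I_def r_def[symmetric])
  qed
  obtain F where F: "finite F" "F \<subseteq> I" and
    van: "\<And>x p. (\<And>f. f \<in> F \<Longrightarrow> mpoly_eval f x = 0) \<Longrightarrow> p \<in> I \<Longrightarrow> mpoly_eval p x = 0"
    using hilbert_basis_zeros[of "{..<n} \<times> {..<n}" I, OF _ _ closed] by (auto simp: I_def)
  from F(2) have "\<forall>f\<in>F. \<exists>i. \<forall>A\<in>C i. mpoly_eval f (($$) A) = 0" by (auto simp: I_def)
  then obtain i where i: "\<And>f A. f \<in> F \<Longrightarrow> A \<in> C (i f) \<Longrightarrow> mpoly_eval f (($$) A) = 0" by metis
  define N where "N = Max (insert 0 (i ` F))"
  have "i f \<le> N" if "f \<in> F" for f using F(1) that by (auto simp: N_def)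
  then have "mpoly_eval f (($$) A) = 0" if "f \<in> F" "A \<in> C N" for f A
    using that i anti by blast
  then have I0: "mpoly_eval p (($$) A) = 0" if "p \<in> I" "A \<in> C N" for p A
    using van that by blast
  obtain Z where "closedin (zariski n) Z" "C (Suc N) = Z \<inter> S"
    using C(1)[of "Suc N"] unfolding T_def closedin_subtopology by auto
  then obtain P where P: "P \<subseteq> entry_polys n"
    "C (Suc N) = {A \<in> carrier_mat n n. \<forall>p\<in>P. mpoly_eval p (($$) A) = 0} \<inter> S"
    unfolding closedin_zariski by auto
  have "C N \<subseteq> carrier_mat n n \<inter> S"
    using closedin_subset[OF C(1)[of N]] by (simp add: T_def)
  moreover have "P \<subseteq> I" using P by (auto simp: I_def intro!: exI[of _ "Suc N"])
  ultimately have "C N \<subseteq> C (Suc N)" using I0 unfolding P(2) by blast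
  then show False using C(2)[of N] by blast
qed

lemma zariski_finite_connected_union:
  fixes S :: "'a::field mat set" and n :: nat
  defines "T \<equiv> subtopology (zariski n) S"
  assumes "closedin T Z"
  shows "\<exists>F. finite F \<and> Z = \<Union>F \<and> (\<forall>Y\<in>F. connectedin T Y)"
  using assms(2)
proof (induction Z rule: wf_induct_rule[OF wf_zariski_closed[of n S, folded T_def]])
  case (1 Z)
  show ?case
  proof (cases "connectedin T Z")
    case True
    then show ?thesis by (intro exI[of _ "{Z}"]) simp
  next
    case False
    then obtain E1 E2 where E: "closedin T E1" "closedin T E2" "Z \<subseteq> E1 \<union> E2"
      "E1 \<inter> E2 \<inter> Z = {}" "E1 \<inter> Z \<noteq> {}" "E2 \<inter> Z \<noteq> {}"
      using closedin_subset[OF 1(2)] unfolding connectedin_closedin by blast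
    have "\<exists>F. finite F \<and> E1 \<inter> Z = \<Union>F \<and> (\<forall>Y\<in>F. connectedin T Y)"
      using 1(1)[of "E1 \<inter> Z"] closedin_Int[OF E(1) 1(2)] 1(2) E(3-6) by blast
    moreover have "\<exists>F. finite F \<and> E2 \<inter> Z = \<Union>F \<and> (\<forall>Y\<in>F. connectedin T Y)"
      using 1(1)[of "E2 \<inter> Z"] closedin_Int[OF E(2) 1(2)] 1(2) E(3-6) by blast
    ultimately obtain F1 F2 where "finite F1" "E1 \<inter> Z = \<Union>F1" "\<forall>Y\<in>F1. connectedin T Y"
      "finite F2" "E2 \<inter> Z = \<Union>F2" "\<forall>Y\<in>F2. connectedin T Y" by blast
    moreover have "Z = (E1 \<inter> Z) \<union> (E2 \<inter> Z)" using E(3) by blast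
    ultimately show ?thesis by (intro exI[of _ "F1 \<union> F2"]) auto
  qed
qed

lemma polyfun_constant_on_connected:
  assumes conn: "connectedin (zariski n) S" and f: "polyfun n f" and fin: "finite (f ` S)"
    and AB: "A \<in> S" "B \<in> S"
  shows "f A = f B"
proof (rule ccontr)
  assume ne: "f A \<noteq> f B"
  have S: "S \<subseteq> carrier_mat n n" using connectedin_subset_topspace[OF conn] by simp
  let ?h = "\<lambda>X. \<Prod>c\<in>f ` S - {f A}. f X - c"
  let ?E1 = "{X \<in> carrier_mat n n. f X - f A = 0}" and ?E2 = "{X \<in> carrier_mat n n. ?h X = 0}"
  have h: "?h X = 0 \<longleftrightarrow> f X \<noteq> f A" if "X \<in> S" for X
    using fin that by auto
  have "\<exists>E1 E2. closedin (zariski n) E1 \<and> closedin (zariski n) E2 \<and>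
    S \<subseteq> E1 \<union> E2 \<and> E1 \<inter> E2 \<inter> S = {} \<and> E1 \<inter> S \<noteq> {} \<and> E2 \<inter> S \<noteq> {}"
  proof (rule exI[of _ ?E1], rule exI[of _ ?E2], intro conjI)
    show "closedin (zariski n) ?E1" "closedin (zariski n) ?E2"
      by (intro closedin_polyfun_eq polyfun_prod polyfun_diff polyfun_const f)+
    show "S \<subseteq> ?E1 \<union> ?E2" "?E1 \<inter> ?E2 \<inter> S = {}"
      using S h by (auto simp del: prod_zero_iff)
    have "A \<in> ?E1 \<inter> S" "B \<in> ?E2 \<inter> S"
      using S AB ne h[of B] by (auto simp del: prod_zero_iff)
    then show "?E1 \<inter> S \<noteq> {}" "?E2 \<inter> S \<noteq> {}" by (metis empty_iff)+
  qed
  then show False using conn unfolding connectedin_closedin by (rule notE[OF conjunct2, rotated])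
qed

lemma group_GL: "group (GL n :: 'a::field mat monoid)"
proof -
  interpret R: ring "ring_mat TYPE('a) n ()" by (rule ring_mat)
  show ?thesis unfolding GL_def by (rule R.units_group)
qed

lemma mult_GL [simp]: "x \<otimes>\<^bsub>GL n\<^esub> y = x * y"
  by (simp add: GL_def units_of_mult ring_mat_simps)

lemma one_GL [simp]: "\<one>\<^bsub>GL n\<^esub> = 1\<^sub>m n"
  by (simp add: GL_def units_of_one ring_mat_simps)

lemma carrier_GL_subset: "carrier (GL n) \<subseteq> carrier_mat n n"
  by (auto simp: GL_def units_of_carrier Units_def ring_mat_simps)

lemma in_carrier_GL:
  assumes "A \<in> carrier_mat n n" "B \<in> carrier_mat n n" "A * B = 1\<^sub>m n" "B * A = 1\<^sub>m n"
  shows "A \<in> carrier (GL n)"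
  using assms by (auto simp: GL_def units_of_carrier Units_def ring_mat_simps)

lemma infinite_identity_component:
  fixes G :: "'a::field mat set"
  assumes G: "subgroup G (GL n)" and inf: "infinite G"
  shows "infinite (identity_component n G)"
proof -
  interpret GL: group "GL n :: 'a mat monoid" by (rule group_GL)
  let ?T = "subtopology (zariski n) G"
  have Gc: "G \<subseteq> carrier_mat n n"
    using subgroup.subset[OF G] carrier_GL_subset by blast
  then have top: "topspace ?T = G" by auto
  obtain F where F: "finite F" "G = \<Union>F" "\<forall>Y\<in>F. connectedin ?T Y"
    using zariski_finite_connected_union[of n G G] closedin_topspace[of ?T] unfolding top by blast
  obtain Y where Y: "Y \<in> F" "infinite Y" using F(1,2) inf by (metis finite_Union)
  then obtain y where y: "y \<in> Y" using infinite_imp_nonempty by blast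
  have YG: "Y \<subseteq> G" using F(2) Y(1) by blast
  have yc: "y \<in> carrier (GL n)" using y YG subgroup.subset[OF G] by blast
  define z where "z = inv\<^bsub>GL n\<^esub> y"
  have zG: "z \<in> G" unfolding z_def using subgroup.m_inv_closed[OF G] y YG by blast
  have zc: "z \<in> carrier (GL n)" using zG subgroup.subset[OF G] by blast
  have "continuous_map ?T ?T (\<lambda>A. z * A)"
  proof (rule continuous_map_into_subtopology)
    show "continuous_map ?T (zariski n) (\<lambda>A. z * A)"
      using continuous_map_times_left[of z n] zG Gc by (intro continuous_map_from_subtopology) auto
    show "(\<lambda>A. z * A) \<in> topspace ?T \<rightarrow> G"
      unfolding top using subgroup.m_closed[OF G zG] by simp
  qed
  then have conn: "connectedin ?T ((\<lambda>A. z * A) ` Y)"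
    using F(3) Y(1) by (blast intro: connectedin_continuous_map_image)
  have "1\<^sub>m n = z * y" using GL.l_inv[OF yc] by (simp add: z_def)
  then have "1\<^sub>m n \<in> (\<lambda>A. z * A) ` Y" using y by blast
  from connected_component_of_maximal[OF conn this]
  have sub: "(\<lambda>A. z * A) ` Y \<subseteq> identity_component n G" by (simp add: identity_component_def)
  have "inj_on (\<lambda>A. z * A) Y"
  proof (rule inj_onI)
    fix A B assume "A \<in> Y" "B \<in> Y" "z * A = z * B"
    then show "A = B"
      using GL.Units_l_cancel[of z A B] zc YG subgroup.subset[OF G] by auto
  qed
  then have "infinite ((\<lambda>A. z * A) ` Y)" using Y(2) by (simp add: finite_image_iff)
  then show ?thesis using sub finite_subset by blast
qed

section \<open>Linear recurrences and the Cayley-Hamilton theorem\<close>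

definition shift_poly :: "'a::comm_ring_1 poly \<Rightarrow> (nat \<Rightarrow> 'a) \<Rightarrow> nat \<Rightarrow> 'a" where
  "shift_poly p x k = (\<Sum>i\<le>degree p. coeff p i * x (k + i))"

lemma shift_poly_superset:
  "degree p \<le> N \<Longrightarrow> shift_poly p x k = (\<Sum>i\<le>N. coeff p i * x (k + i))"
  unfolding shift_poly_def by (rule sum.mono_neutral_left) (auto simp: coeff_eq_0)

lemma shift_poly_0 [simp]: "shift_poly 0 x k = 0"
  by (simp add: shift_poly_def)

lemma shift_poly_pCons: "shift_poly (pCons a p) x k = a * x k + shift_poly p x (Suc k)"
proof -
  have "shift_poly (pCons a p) x k = (\<Sum>i\<le>Suc (degree p). coeff (pCons a p) i * x (k + i))"
    by (rule shift_poly_superset) (simp add: degree_pCons_le)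
  also have "\<dots> = a * x k + (\<Sum>i\<le>degree p. coeff p i * x (Suc k + i))"
    by (subst sum.atMost_Suc_shift) simp
  finally show ?thesis by (simp add: shift_poly_def)
qed

lemma shift_poly_add: "shift_poly (p + q) x k = shift_poly p x k + shift_poly q x k"
proof -
  let ?N = "max (degree p) (degree q)"
  have "degree (p + q) \<le> ?N" by (rule degree_add_le_max)
  then show ?thesis
    by (simp add: shift_poly_superset[of _ ?N] distrib_right sum.distrib)
qed

lemma shift_poly_smult: "shift_poly (smult a p) x k = a * shift_poly p x k"
  using shift_poly_superset[of "smult a p" "degree p" x k]
  by (simp add: shift_poly_def degree_smult_le sum_distrib_left mult.assoc)

lemma shift_poly_mult: "shift_poly (p * q) x k = shift_poly p (shift_poly q x) k"
proof (induction p arbitrary: k)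
  case (pCons a p)
  then show ?case by (simp add: shift_poly_pCons shift_poly_add shift_poly_smult)
qed simp

lemma shift_poly_1 [simp]: "shift_poly 1 x = x"
  by (rule ext) (simp add: shift_poly_def)

lemma shift_poly_seq_0 [simp]: "shift_poly p (\<lambda>k. 0) = (\<lambda>k. 0)"
  by (rule ext) (simp add: shift_poly_def)

lemma shift_poly_seq_add:
  "shift_poly p (\<lambda>k. x k + y k) k = shift_poly p x k + shift_poly p y k"
  by (simp add: shift_poly_def distrib_left sum.distrib)

lemma shift_poly_seq_sum:
  "shift_poly p (\<lambda>k. \<Sum>i\<in>I. x i k) k = (\<Sum>i\<in>I. shift_poly p (x i) k)"
  by (induction I rule: infinite_finite_induct) (simp_all add: shift_poly_seq_add)

lemma shift_poly_seq_Suc: "shift_poly p (\<lambda>k. x (Suc k)) k = shift_poly p x (Suc k)"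
  by (simp add: shift_poly_def)

lemma shift_poly_const: "shift_poly p (\<lambda>k. c) k = poly p 1 * c"
  by (simp add: shift_poly_def poly_altdef sum_distrib_right)

lemma shift_poly_linear: "shift_poly [:- a, 1:] x = (\<lambda>k. x (Suc k) - a * x k)"
  by (rule ext) (simp add: shift_poly_pCons)

text \<open>For \<open>a \<noteq> 0\<close> and in characteristic zero these are the sequences polynomial times
  \<open>a ^ k\<close>; the description by a difference equation works in every characteristic.\<close>

definition expseq :: "'a::comm_ring_1 \<Rightarrow> (nat \<Rightarrow> 'a) \<Rightarrow> bool" where
  "expseq a x \<longleftrightarrow> (\<exists>m. shift_poly ([:- a, 1:] ^ m) x = (\<lambda>k. 0))"

lemma shift_poly_linear_power_Suc:
  "shift_poly ([:- a, 1:] ^ Suc m) x = shift_poly ([:- a, 1:] ^ m) (\<lambda>k. x (Suc k) - a * x k)"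
  by (rule ext) (simp only: power_Suc2 shift_poly_mult shift_poly_linear)

lemma expseq_power: "expseq a (\<lambda>k. a ^ k)"
  unfolding expseq_def by (rule exI[of _ 1]) (simp add: shift_poly_linear)

lemma expseq_const: "expseq 1 (\<lambda>k. c)"
  unfolding expseq_def by (rule exI[of _ 1]) (simp add: shift_poly_linear[of 1, simplified])

lemma shift_poly_power_mult_aux:
  "shift_poly ([:- a, 1:] ^ m) x = (\<lambda>k. 0) \<Longrightarrow> shift_poly ([:- b, 1:] ^ l) y = (\<lambda>k. 0) \<Longrightarrow>
    shift_poly ([:- (a * b), 1:] ^ (m + l)) (\<lambda>k. x k * y k) = (\<lambda>k. 0)"
proof (induction "m + l" arbitrary: m l x y)
  case 0
  then show ?case by (simp add: fun_eq_iff)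
next
  case (Suc s)
  show ?case
  proof (cases "m = 0 \<or> l = 0")
    case True
    then have "(\<lambda>k. x k * y k) = (\<lambda>k. 0)"
      using Suc.prems by (auto simp: fun_eq_iff)
    then show ?thesis by simp
  next
    case False
    then obtain m' l' where ml: "m = Suc m'" "l = Suc l'" using not0_implies_Suc by blast
    let ?dx = "\<lambda>k. x (Suc k) - a * x k" and ?dy = "\<lambda>k. y (Suc k) - b * y k"
    have dx: "shift_poly ([:- a, 1:] ^ m') ?dx = (\<lambda>k. 0)"
      using Suc.prems(1) unfolding ml shift_poly_linear_power_Suc .
    have dy: "shift_poly ([:- b, 1:] ^ l') ?dy = (\<lambda>k. 0)"
      using Suc.prems(2) unfolding ml shift_poly_linear_power_Suc .
    have Ey: "shift_poly ([:- b, 1:] ^ l) (\<lambda>k. y (Suc k)) = (\<lambda>k. 0)"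
      using Suc.prems(2) by (simp add: fun_eq_iff shift_poly_seq_Suc)
    have ax: "shift_poly ([:- a, 1:] ^ m) (\<lambda>k. a * x k) = (\<lambda>k. 0)"
    proof -
      have "shift_poly p (\<lambda>k. a * x k) k = a * shift_poly p x k" for p k
        by (simp add: shift_poly_def sum_distrib_left mult_ac)
      then show ?thesis using Suc.prems(1) by (simp add: fun_eq_iff)
    qed
    have 1: "shift_poly ([:- (a * b), 1:] ^ (m' + l)) (\<lambda>k. ?dx k * y (Suc k)) = (\<lambda>k. 0)"
      by (rule Suc.hyps(1)[OF _ dx Ey]) (use Suc.hyps(2) ml in simp)
    have 2: "shift_poly ([:- (a * b), 1:] ^ (m + l')) (\<lambda>k. (a * x k) * ?dy k) = (\<lambda>k. 0)"
      by (rule Suc.hyps(1)[OF _ ax dy]) (use Suc.hyps(2) ml in simp)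
    have s: "m + l = Suc s" "m' + l = s" "m + l' = s" using Suc.hyps(2) ml by simp_all
    have "x (Suc k) * y (Suc k) - a * b * (x k * y k) = ?dx k * y (Suc k) + (a * x k) * ?dy k" for k
      by (simp add: algebra_simps)
    then have "shift_poly ([:- (a * b), 1:] ^ (m + l)) (\<lambda>k. x k * y k) k =
        shift_poly ([:- (a * b), 1:] ^ s) (\<lambda>k. ?dx k * y (Suc k) + (a * x k) * ?dy k) k" for k
      unfolding s(1) shift_poly_linear_power_Suc by simp
    then show ?thesis using 1 2 unfolding s by (simp add: shift_poly_seq_add fun_eq_iff)
  qed
qed

lemma expseq_mult: "expseq a x \<Longrightarrow> expseq b y \<Longrightarrow> expseq (a * b) (\<lambda>k. x k * y k)"
  unfolding expseq_def using shift_poly_power_mult_aux by blast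

lemma expseq_pow: "expseq a x \<Longrightarrow> expseq (a ^ m) (\<lambda>k. x k ^ m)"
  by (induction m) (simp_all add: expseq_const expseq_mult)

lemma expseq_prod:
  "(\<And>i. i \<in> I \<Longrightarrow> expseq (a i) (x i)) \<Longrightarrow> expseq (\<Prod>i\<in>I. a i) (\<lambda>k. \<Prod>i\<in>I. x i k)"
  by (induction I rule: infinite_finite_induct) (simp_all add: expseq_const expseq_mult)

lemma sum_expseq_constant:
  fixes x :: "'i \<Rightarrow> nat \<Rightarrow> 'a::idom"
  assumes "\<And>i. i \<in> I \<Longrightarrow> expseq (a i) (x i)" "\<And>i. i \<in> I \<Longrightarrow> a i \<noteq> 1"
    and sum: "\<And>k. (\<Sum>i\<in>I. x i k) = c"
  shows "c = 0"
proof (cases "finite I")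
  case True
  have "\<forall>i\<in>I. \<exists>m. shift_poly ([:- a i, 1:] ^ m) (x i) = (\<lambda>k. 0)"
    using assms(1) by (simp add: expseq_def)
  then obtain m where m: "\<And>i. i \<in> I \<Longrightarrow> shift_poly ([:- a i, 1:] ^ m i) (x i) = (\<lambda>k. 0)"
    by metis
  define P where "P = (\<Prod>i\<in>I. [:- a i, 1:] ^ m i)"
  have "shift_poly P (x i) k = 0" if i: "i \<in> I" for i k
  proof -
    have "P = (\<Prod>j\<in>I - {i}. [:- a j, 1:] ^ m j) * [:- a i, 1:] ^ m i"
      unfolding P_def using True i by (subst prod.remove[of I i]) (simp_all add: mult.commute)
    then show ?thesis by (simp add: shift_poly_mult m[OF i])
  qed
  then have "shift_poly P (\<lambda>k. \<Sum>i\<in>I. x i k) 0 = 0" by (simp add: shift_poly_seq_sum)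
  then have "poly P 1 * c = 0" unfolding sum shift_poly_const .
  moreover have "poly P 1 \<noteq> 0" using True assms(2) by (auto simp: P_def poly_prod poly_power)
  ultimately show ?thesis by simp
qed (use sum in simp)

text \<open>The Cayley-Hamilton theorem: compare coefficients in
  \<open>(X - A) * adj (X - A) = char_poly A\<close> and telescope.\<close>

lemma shift_poly_char_poly:
  fixes A :: "'a::comm_ring_1 mat"
  assumes A: "A \<in> carrier_mat n n" and ij: "i < n" "j < n"
  shows "shift_poly (char_poly A) (\<lambda>k. (A ^\<^sub>m k) $$ (i, j)) k = 0"
proof -
  let ?M = "char_poly_matrix A"
  let ?N = "adj_mat ?M"
  have M: "?M \<in> carrier_mat n n" using A by simp
  have N: "?N \<in> carrier_mat n n" by (rule adj_mat(1)[OF M])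
  have prod: "?M * ?N = char_poly A \<cdot>\<^sub>m 1\<^sub>m n"
    using adj_mat(2)[OF M] by (simp add: char_poly_def)
  define B where "B l a = coeff (?N $$ (a, j)) l" for l a
  have eq: "coeff (char_poly A) l * (if a = j then 1 else 0) =
    (if l = 0 then 0 else B (l - 1) a) - (\<Sum>c<n. A $$ (a, c) * B l c)" if a: "a < n" for l a
  proof -
    have entry: "?M $$ (a, c) = (if a = c then [:0, 1:] else 0) - [:A $$ (a, c):]" if "c < n" for c
      using A a that by (simp add: char_poly_matrix_def)
    have "(if a = j then char_poly A else 0) = (?M * ?N) $$ (a, j)"
      unfolding prod using a ij by simp
    also have "\<dots> = (\<Sum>c<n. ?M $$ (a, c) * ?N $$ (c, j))"
      by (rule index_mult_mat_sum[OF M N a ij(2)])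
    also have "\<dots> = (\<Sum>c<n. (if a = c then [:0, 1:] * ?N $$ (a, j) else 0) -
        smult (A $$ (a, c)) (?N $$ (c, j)))"
      by (intro sum.cong refl) (auto simp: entry left_diff_distrib)
    also have "\<dots> = pCons 0 (?N $$ (a, j)) - (\<Sum>c<n. smult (A $$ (a, c)) (?N $$ (c, j)))"
      using a by (simp add: sum_subtractf)
    finally have "coeff (if a = j then char_poly A else 0) l =
      coeff (pCons 0 (?N $$ (a, j))) l - (\<Sum>c<n. A $$ (a, c) * B l c)"
      by (simp add: coeff_sum B_def)
    then show ?thesis by (cases l) (auto simp: B_def split: if_splits)
  qed
  define L where "L = Max (insert (degree (char_poly A)) ((\<lambda>a. Suc (degree (?N $$ (a, j)))) ` {..<n}))"
  have BL: "B L a = 0" if "a < n" for a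
  proof -
    have "Suc (degree (?N $$ (a, j))) \<le> L" unfolding L_def by (rule Max_ge) (use that in auto)
    then show ?thesis by (simp add: B_def coeff_eq_0)
  qed
  define g where "g l = (if l = 0 then 0 else \<Sum>a<n. (A ^\<^sub>m (k + l)) $$ (i, a) * B (l - 1) a)" for l
  have step: "coeff (char_poly A) l * (A ^\<^sub>m (k + l)) $$ (i, j) = g l - g (Suc l)" for l
  proof -
    have P: "A ^\<^sub>m (k + l) \<in> carrier_mat n n" using A by simp
    have "coeff (char_poly A) l * (A ^\<^sub>m (k + l)) $$ (i, j) =
      (\<Sum>a<n. (A ^\<^sub>m (k + l)) $$ (i, a) * (coeff (char_poly A) l * (if a = j then 1 else 0)))"
    proof -
      have "(\<Sum>a<n. (A ^\<^sub>m (k + l)) $$ (i, a) * (coeff (char_poly A) l * (if a = j then 1 else 0))) =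
          (\<Sum>a<n. if a = j then coeff (char_poly A) l * (A ^\<^sub>m (k + l)) $$ (i, j) else 0)"
        by (intro sum.cong) auto
      then show ?thesis using ij(2) by simp
    qed
    also have "\<dots> = (\<Sum>a<n. (A ^\<^sub>m (k + l)) $$ (i, a) *
        ((if l = 0 then 0 else B (l - 1) a) - (\<Sum>c<n. A $$ (a, c) * B l c)))"
      by (intro sum.cong refl) (simp only: eq lessThan_iff)
    also have "\<dots> = g l - (\<Sum>a<n. \<Sum>c<n. (A ^\<^sub>m (k + l)) $$ (i, a) * A $$ (a, c) * B l c)"
      by (simp add: right_diff_distrib sum_subtractf g_def sum_distrib_left mult.assoc)
    also have "(\<Sum>a<n. \<Sum>c<n. (A ^\<^sub>m (k + l)) $$ (i, a) * A $$ (a, c) * B l c) =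
        (\<Sum>c<n. (A ^\<^sub>m (k + l) * A) $$ (i, c) * B l c)"
      by (subst sum.swap) (simp add: index_mult_mat_sum[OF P A ij(1)] sum_distrib_right del: index_mult_mat)
    also have "\<dots> = g (Suc l)" by (simp add: g_def)
    finally show ?thesis .
  qed
  have "shift_poly (char_poly A) (\<lambda>k. (A ^\<^sub>m k) $$ (i, j)) k =
      (\<Sum>l\<le>L. coeff (char_poly A) l * (A ^\<^sub>m (k + l)) $$ (i, j))"
    by (rule shift_poly_superset) (simp add: L_def)
  also have "\<dots> = (\<Sum>l\<le>L. g l - g (Suc l))" by (simp only: step)
  also have "\<dots> = g 0 - g (Suc L)" by (rule sum_telescope)
  also have "\<dots> = 0" by (simp add: g_def BL)
  finally show ?thesis .
qed

lemma mat_pow_add: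
  "A \<in> carrier_mat n n \<Longrightarrow> A ^\<^sub>m (k + l) = A ^\<^sub>m k * (A ^\<^sub>m l :: 'a::semiring_1 mat)"
  by (induction l) (simp_all add: assoc_mult_mat[of _ n n _ n _ n])

lemma char_poly_nonzero: "A \<in> carrier_mat n n \<Longrightarrow> char_poly (A :: 'a::field mat) \<noteq> 0"
  using degree_monic_char_poly[of A n] by auto

text \<open>The factor \<open>q\<close> of the characteristic polynomial prime to the eigenvalue projects an
  arbitrary covector to a generalized left eigenvector; it acts on an eigenvector by a nonzero
  scalar.\<close>

lemma generalized_eigenvector_pairing:
  fixes A :: "'a::field mat"
  assumes A: "A \<in> carrier_mat n n" and "eigenvalue A a"
  obtains u l where "u \<in> carrier_vec n" "A *\<^sub>v u = a \<cdot>\<^sub>v u" "(\<Sum>i<n. l i * u $ i) \<noteq> 0"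
    "\<And>j. j < n \<Longrightarrow> expseq a (\<lambda>k. \<Sum>i<n. l i * (A ^\<^sub>m k) $$ (i, j))"
proof -
  obtain u where u: "eigenvector A u a" using assms(2) by (auto simp: eigenvalue_def)
  then have uc: "u \<in> carrier_vec n" "u \<noteq> 0\<^sub>v n" "A *\<^sub>v u = a \<cdot>\<^sub>v u"
    using A by (auto simp: eigenvector_def)
  obtain r where r: "r < n" "u $ r \<noteq> 0"
    using uc(1,2) by (metis carrier_vecD eq_vecI index_zero_vec(1) index_zero_vec(2))
  obtain q where q: "char_poly A = [:- a, 1:] ^ order a (char_poly A) * q" "\<not> [:- a, 1:] dvd q"
    using order_decomp[OF char_poly_nonzero[OF A]] by blast
  define l where "l i = shift_poly q (\<lambda>k. (A ^\<^sub>m k) $$ (r, i)) 0" for i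
  have pow: "A ^\<^sub>m k *\<^sub>v u = a ^ k \<cdot>\<^sub>v u" for k by (rule eigenvector_pow[OF A u])
  have seq: "(\<Sum>i<n. l i * (A ^\<^sub>m k) $$ (i, j)) = shift_poly q (\<lambda>k. (A ^\<^sub>m k) $$ (r, j)) k"
    if j: "j < n" for j k
  proof -
    have "(\<Sum>i<n. l i * (A ^\<^sub>m k) $$ (i, j)) =
      (\<Sum>d\<le>degree q. coeff q d * (\<Sum>i<n. (A ^\<^sub>m d) $$ (r, i) * (A ^\<^sub>m k) $$ (i, j)))"
      unfolding l_def shift_poly_def sum_distrib_right sum_distrib_left
      by (subst sum.swap) (simp add: mult.assoc)
    also have "\<dots> = (\<Sum>d\<le>degree q. coeff q d * (A ^\<^sub>m (k + d)) $$ (r, j))"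
      using A r(1) j by (simp add: mat_pow_add add.commute[of k] index_mult_mat_sum[of _ n n _ n] del: index_mult_mat)
    finally show ?thesis by (simp add: shift_poly_def)
  qed
  have ex: "expseq a (\<lambda>k. \<Sum>i<n. l i * (A ^\<^sub>m k) $$ (i, j))" if j: "j < n" for j
    unfolding expseq_def
  proof (intro exI ext)
    fix k
    have eq: "(\<lambda>k. \<Sum>i<n. l i * (A ^\<^sub>m k) $$ (i, j)) = shift_poly q (\<lambda>k. (A ^\<^sub>m k) $$ (r, j))"
      using seq[OF j] by blast
    show "shift_poly ([:- a, 1:] ^ order a (char_poly A)) (\<lambda>k. \<Sum>i<n. l i * (A ^\<^sub>m k) $$ (i, j)) k = 0"
      unfolding eq shift_poly_mult[symmetric] q(1)[symmetric]
      by (rule shift_poly_char_poly[OF A r(1) j])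
  qed
  have val: "(\<Sum>i<n. l i * u $ i) = poly q a * u $ r"
  proof -
    have "(\<Sum>i<n. l i * u $ i) = (\<Sum>d\<le>degree q. coeff q d * (\<Sum>i<n. (A ^\<^sub>m d) $$ (r, i) * u $ i))"
      unfolding l_def shift_poly_def sum_distrib_right sum_distrib_left
      by (subst sum.swap) (simp add: mult.assoc)
    also have "(\<Sum>i<n. (A ^\<^sub>m d) $$ (r, i) * u $ i) = (A ^\<^sub>m d *\<^sub>v u) $ r" for d
      using A r(1) uc(1) by (simp add: scalar_prod_def atLeast0LessThan)
    then have "(\<Sum>d\<le>degree q. coeff q d * (\<Sum>i<n. (A ^\<^sub>m d) $$ (r, i) * u $ i)) = poly q a * u $ r"
      using r(1) uc(1) by (simp add: pow poly_altdef sum_distrib_right mult.assoc)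
    finally show ?thesis .
  qed
  have "poly q a \<noteq> 0" using q(2) by (simp add: poly_eq_0_iff_dvd)
  then have "(\<Sum>i<n. l i * u $ i) \<noteq> 0" using val r(2) by simp
  from that[OF uc(1,3) this ex] show thesis .
qed

lemma char_poly_splits:
  fixes A :: "'a::alg_closed_field mat"
  assumes A: "A \<in> carrier_mat n n"
  obtains es where "length es = n" "char_poly A = (\<Prod>e\<leftarrow>es. [:- e, 1:])"
    "\<And>e. e \<in> set es \<Longrightarrow> eigenvalue A e"
proof -
  obtain E where E: "size E = degree (char_poly A)"
    "char_poly A = smult (lead_coeff (char_poly A)) (\<Prod>e\<in>#E. [:- e, 1:])"
    using alg_closed_imp_factorization[OF char_poly_nonzero[OF A]] by blast
  obtain es where es: "mset es = E" using ex_mset by blast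
  have deg: "degree (char_poly A) = n" "lead_coeff (char_poly A) = 1"
    using degree_monic_char_poly[OF A] by auto
  have "(\<Prod>e\<in>#E. [:- e, 1:]) = (\<Prod>e\<leftarrow>es. [:- e, 1:])"
    unfolding es[symmetric] by (simp add: prod_mset_prod_list[symmetric])
  then have cp: "char_poly A = (\<Prod>e\<leftarrow>es. [:- e, 1:])" using E(2) deg(2) by simp
  have "eigenvalue A e" if "e \<in> set es" for e
    unfolding eigenvalue_root_char_poly[OF A] cp using that
    by (induction es) auto
  then show thesis using that[OF _ cp] E(1) es deg(1) by (metis size_mset)
qed

lemma unipotent_of_eigenvalues:
  fixes A :: "'a::alg_closed_field mat"
  assumes A: "A \<in> carrier_mat n n" and ev: "\<And>a. eigenvalue A a \<Longrightarrow> a = 1"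
  shows "(A - 1\<^sub>m n) ^\<^sub>m n = 0\<^sub>m n n"
proof -
  obtain es where es: "length es = n" "char_poly A = (\<Prod>e\<leftarrow>es. [:- e, 1:])"
    "\<And>e. e \<in> set es \<Longrightarrow> eigenvalue A e" using char_poly_splits[OF A] by metis
  have "es = replicate n 1" using es(1,3) ev by (metis replicate_eqI)
  then have cp: "char_poly A = [:- 1, 1:] ^ n" by (simp add: es(2))
  let ?D = "A - 1\<^sub>m n"
  have D: "?D \<in> carrier_mat n n" by (rule minus_carrier_mat) simp
  have *: "shift_poly ([:- 1, 1:] ^ m) (\<lambda>k. (A ^\<^sub>m k) $$ (i, j)) = (\<lambda>k. (?D ^\<^sub>m m * A ^\<^sub>m k) $$ (i, j))"
    if ij: "i < n" "j < n" for i j m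
  proof (induction m)
    case 0
    show ?case using A ij by simp
  next
    case (Suc m)
    have P: "?D ^\<^sub>m m \<in> carrier_mat n n" "A ^\<^sub>m k \<in> carrier_mat n n" for k
      by (intro pow_carrier_mat D A)+
    have "?D ^\<^sub>m Suc m * A ^\<^sub>m k = ?D ^\<^sub>m m * A ^\<^sub>m Suc k - ?D ^\<^sub>m m * A ^\<^sub>m k" for k
    proof -
      have "?D ^\<^sub>m Suc m * A ^\<^sub>m k = ?D ^\<^sub>m m * (?D * A ^\<^sub>m k)"
        using P D by (simp add: assoc_mult_mat[of _ n n _ n _ n])
      also have "?D * A ^\<^sub>m k = A * A ^\<^sub>m k - A ^\<^sub>m k"
        using minus_mult_distrib_mat[OF A one_carrier_mat P(2)[of k]] left_mult_one_mat[OF P(2)[of k]] by simp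
      also have "A * A ^\<^sub>m k = A ^\<^sub>m Suc k"
        using mat_pow_add[OF A, of 1 k] A by simp
      finally show ?thesis using mult_minus_distrib_mat[OF P(1) P(2)[of "Suc k"] P(2)[of k]] by simp
    qed
    moreover have "?D ^\<^sub>m m * A ^\<^sub>m k \<in> carrier_mat n n" for k
      by (rule mult_carrier_mat[OF P])
    ultimately have ent: "(?D ^\<^sub>m Suc m * A ^\<^sub>m k) $$ (i, j) =
      (?D ^\<^sub>m m * A ^\<^sub>m Suc k) $$ (i, j) - (?D ^\<^sub>m m * A ^\<^sub>m k) $$ (i, j)" for k
      using ij by (metis carrier_matD index_minus_mat(1))
    show ?case
      by (rule ext) (simp only: power_Suc shift_poly_mult Suc.IH shift_poly_linear ent mult_1_left)
  qed
  show ?thesis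
  proof (rule eq_matI)
    fix i j assume "i < dim_row (0\<^sub>m n n)" "j < dim_col (0\<^sub>m n n)"
    then have ij: "i < n" "j < n" by simp_all
    have "(?D ^\<^sub>m n) $$ (i, j) = (?D ^\<^sub>m n * A ^\<^sub>m 0) $$ (i, j)" using A by simp
    also have "\<dots> = shift_poly (char_poly A) (\<lambda>k. (A ^\<^sub>m k) $$ (i, j)) 0"
      unfolding cp *[OF ij] ..
    also have "\<dots> = 0" by (rule shift_poly_char_poly[OF A ij])
    finally show "(?D ^\<^sub>m n) $$ (i, j) = 0\<^sub>m n n $$ (i, j)" using ij by simp
  qed (use pow_carrier_mat[OF D, of n] in auto)
qed

section \<open>A module with invariants of large degree\<close>

lemma regular_on_polyfun:
  assumes "polyfun n p" "G \<subseteq> carrier_mat n n" "\<And>g. g \<in> G \<Longrightarrow> f g = p g / det g ^ e"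
  shows "regular_on n G f"
proof -
  obtain q where "q \<in> entry_polys n" "\<forall>A\<in>carrier_mat n n. p A = mpoly_eval q (($$) A)"
    using assms(1) by (auto simp: polyfun_def)
  then show ?thesis
    unfolding regular_on_def using assms(2,3) by (intro bexI[of _ q] exI[of _ e]) auto
qed

lemma GL_inv:
  fixes g :: "'a::field mat"
  assumes "g \<in> carrier (GL n)"
  shows "inv\<^bsub>GL n\<^esub> g \<in> carrier (GL n)" "g * inv\<^bsub>GL n\<^esub> g = 1\<^sub>m n" "inv\<^bsub>GL n\<^esub> g * g = 1\<^sub>m n"
  using group.inv_closed[OF group_GL assms] group.r_inv[OF group_GL assms]
    group.l_inv[OF group_GL assms] by simp_all

lemma GL_carrier_mat: "g \<in> carrier (GL n) \<Longrightarrow> g \<in> carrier_mat n n"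
  using carrier_GL_subset by blast

lemma GL_inv_eq:
  fixes g :: "'a::field mat"
  assumes g: "g \<in> carrier (GL n)"
  shows "inv\<^bsub>GL n\<^esub> g = (1 / det g) \<cdot>\<^sub>m adj_mat g"
proof -
  let ?h = "inv\<^bsub>GL n\<^esub> g"
  have gc: "g \<in> carrier_mat n n" and hc: "?h \<in> carrier_mat n n"
    using GL_carrier_mat g GL_inv(1)[OF g] by blast+
  note adj = adj_mat[OF gc]
  have "det g * det ?h = 1"
    using det_mult[OF gc hc] GL_inv(2)[OF g] by simp
  then have d: "det g \<noteq> 0" by auto
  have "adj_mat g = ?h * (g * adj_mat g)"
    using assoc_mult_mat[OF hc gc adj(1)] GL_inv(3)[OF g] adj(1) by simp
  also have "\<dots> = det g \<cdot>\<^sub>m ?h"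
    using hc by (simp add: adj(2) mult_smult_distrib[of _ n n _ n])
  finally have "(1 / det g) \<cdot>\<^sub>m adj_mat g = (1 / det g) \<cdot>\<^sub>m (det g \<cdot>\<^sub>m ?h)" by simp
  also have "\<dots> = ?h" using d by (intro eq_matI) auto
  finally show ?thesis by simp
qed

lemma polyfun_adj_mat:
  assumes "i < n" "j < n"
  shows "polyfun n (\<lambda>A. adj_mat A $$ (i, j))"
proof -
  have "polyfun n (\<lambda>A. (-1) ^ (j + i) * det (mat_delete A j i))"
  proof (intro polyfun_mult polyfun_const polyfun_det)
    fix k l assume kl: "k < n - 1" "l < n - 1"
    then have "polyfun n (\<lambda>A. A $$ (if k < j then k else Suc k, if l < i then l else Suc l))"
      by (intro polyfun_entry) auto
    then show "polyfun n (\<lambda>A. mat_delete A j i $$ (k, l))"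
      by (subst polyfun_cong) (use kl in \<open>auto simp: mat_delete_def\<close>)
  qed (rule mat_delete_carrier)
  then show ?thesis
    by (subst polyfun_cong) (use assms in \<open>auto simp: adj_mat_def cofactor_def\<close>)
qed

lemma rational_rep_of_entries:
  fixes G :: "'a::field mat set" and R :: "'a mat \<Rightarrow> 'i \<Rightarrow> 'i \<Rightarrow> 'a"
  assumes G: "subgroup G (GL n)" and e: "bij_betw e {..<m} I"
    and one: "\<And>x y. x \<in> I \<Longrightarrow> y \<in> I \<Longrightarrow> R (1\<^sub>m n) x y = (if x = y then 1 else 0)"
    and mult: "\<And>g h x y. g \<in> G \<Longrightarrow> h \<in> G \<Longrightarrow> x \<in> I \<Longrightarrow> y \<in> I \<Longrightarrow>
      R (g * h) x y = (\<Sum>z\<in>I. R g x z * R h z y)"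
    and reg: "\<And>x y. x \<in> I \<Longrightarrow> y \<in> I \<Longrightarrow> regular_on n G (\<lambda>g. R g x y)"
  shows "rational_rep n G m (\<lambda>g. mat m m (\<lambda>(i, j). R g (e i) (e j)))"
proof -
  define \<rho> where "\<rho> g = mat m m (\<lambda>(i, j). R g (e i) (e j))" for g
  have eI: "e i \<in> I" if "i < m" for i using e that by (auto simp: bij_betw_def)
  have e_eq: "e i = e j \<longleftrightarrow> i = j" if "i < m" "j < m" for i j
    using e that by (auto simp: bij_betw_def inj_on_eq_iff)
  have \<rho>c: "\<rho> g \<in> carrier_mat m m" for g by (simp add: \<rho>_def)
  have \<rho>1: "\<rho> (1\<^sub>m n) = 1\<^sub>m m"
    by (rule eq_matI) (auto simp: \<rho>_def one eI e_eq)
  have \<rho>m: "\<rho> (g * h) = \<rho> g * \<rho> h" if gh: "g \<in> G" "h \<in> G" for g h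
  proof (rule eq_matI)
    fix i j assume "i < dim_row (\<rho> g * \<rho> h)" "j < dim_col (\<rho> g * \<rho> h)"
    then have ij: "i < m" "j < m" by (simp_all add: \<rho>_def)
    have "\<rho> (g * h) $$ (i, j) = (\<Sum>z\<in>I. R g (e i) z * R h z (e j))"
      using ij by (simp add: \<rho>_def mult[OF gh eI eI])
    also have "\<dots> = (\<Sum>k<m. R g (e i) (e k) * R h (e k) (e j))"
      by (rule sum.reindex_bij_betw[OF e, symmetric])
    also have "\<dots> = (\<rho> g * \<rho> h) $$ (i, j)"
      unfolding index_mult_mat_sum[OF \<rho>c \<rho>c ij] using ij by (simp add: \<rho>_def)
    finally show "\<rho> (g * h) $$ (i, j) = (\<rho> g * \<rho> h) $$ (i, j)" .
  qed (simp_all add: \<rho>_def)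
  have "\<rho> g \<in> carrier (GL m)" if g: "g \<in> G" for g
  proof -
    have gc: "g \<in> carrier (GL n)" using g subgroup.subset[OF G] by blast
    have h: "inv\<^bsub>GL n\<^esub> g \<in> G" using subgroup.m_inv_closed[OF G g] .
    show ?thesis
      using \<rho>m[OF g h] \<rho>m[OF h g] GL_inv(2,3)[OF gc] \<rho>1
      by (intro in_carrier_GL[of _ m "\<rho> (inv\<^bsub>GL n\<^esub> g)"] \<rho>c) simp_all
  qed
  then have "\<rho> \<in> hom ((GL n)\<lparr>carrier := G\<rparr>) (GL m)"
    using \<rho>m by (intro homI) simp_all
  moreover have "regular_on n G (\<lambda>g. \<rho> g $$ (i, j))" if "i < m" "j < m" for i j
    using reg[OF eI eI] that by (simp add: \<rho>_def)
  ultimately show ?thesis unfolding rational_rep_def \<rho>_def[symmetric] by blast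
qed

text \<open>The module is the direct sum of the natural module (indices \<open>Inl i\<close>) and the
  \<open>d\<close>-th tensor power of its dual (indices \<open>Inr J\<close> for multi-indices \<open>J\<close>).\<close>

definition tensor_idx :: "nat \<Rightarrow> nat \<Rightarrow> (nat + (nat \<Rightarrow> nat)) set" where
  "tensor_idx n d = {..<n} <+> ({..<d} \<rightarrow>\<^sub>E {..<n})"

fun tensor_entry :: "nat \<Rightarrow> nat \<Rightarrow> 'a::field mat \<Rightarrow> nat + (nat \<Rightarrow> nat) \<Rightarrow> nat + (nat \<Rightarrow> nat) \<Rightarrow> 'a" where
  "tensor_entry n d g (Inl i) (Inl j) = g $$ (i, j)"
| "tensor_entry n d g (Inr I) (Inr J) = (\<Prod>k<d. (inv\<^bsub>GL n\<^esub> g) $$ (J k, I k))"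
| "tensor_entry n d g (Inl i) (Inr J) = 0"
| "tensor_entry n d g (Inr I) (Inl j) = 0"

lemma finite_tensor_idx [simp]: "finite (tensor_idx n d)"
  by (auto simp: tensor_idx_def intro: finite_PiE)

lemma sum_tensor_idx:
  "(\<Sum>z\<in>tensor_idx n d. f z) = (\<Sum>i<n. f (Inl i)) + (\<Sum>I\<in>{..<d} \<rightarrow>\<^sub>E {..<n}. f (Inr I))"
  unfolding tensor_idx_def by (subst sum.Plus) (auto intro: finite_PiE)

lemma prod_sum_multiindex:
  fixes f :: "nat \<Rightarrow> nat \<Rightarrow> 'a::comm_semiring_1"
  shows "(\<Sum>I\<in>{..<d} \<rightarrow>\<^sub>E {..<n}. \<Prod>k<d. f k (I k)) = (\<Prod>k<d. \<Sum>i<n. f k i)"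
  by (rule prod_sum_PiE[symmetric]) simp_all

lemma multiindex_less: "I \<in> {..<d} \<rightarrow>\<^sub>E {..<n} \<Longrightarrow> k < d \<Longrightarrow> I k < n"
  by (auto simp: PiE_def)

lemma rational_rep_tensor:
  fixes G :: "'a::field mat set"
  assumes G: "subgroup G (GL n)" and e: "bij_betw e {..<m} (tensor_idx n d)"
  shows "rational_rep n G m (\<lambda>g. mat m m (\<lambda>(i, j). tensor_entry n d g (e i) (e j)))"
proof (rule rational_rep_of_entries[OF G e])
  have Gc: "g \<in> carrier (GL n)" if "g \<in> G" for g using that subgroup.subset[OF G] by blast
  have inv1: "inv\<^bsub>GL n\<^esub> (1\<^sub>m n) = (1\<^sub>m n :: 'a mat)"
    using group.is_monoid[OF group_GL, THEN monoid.inv_one, of n] by simp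
  fix x y assume x: "x \<in> tensor_idx n d" and y: "y \<in> tensor_idx n d"
  show "tensor_entry n d (1\<^sub>m n) x y = (if x = y then 1 else 0 :: 'a)"
  proof (cases x; cases y)
    fix I J assume IJ: "x = Inr I" "y = Inr J"
    then have PE: "I \<in> {..<d} \<rightarrow>\<^sub>E {..<n}" "J \<in> {..<d} \<rightarrow>\<^sub>E {..<n}"
      using x y by (auto simp: tensor_idx_def)
    have "tensor_entry n d (1\<^sub>m n) x y = (\<Prod>k<d. if J k = I k then 1 else 0 :: 'a)"
      unfolding IJ tensor_entry.simps inv1
      by (intro prod.cong refl) (use PE in \<open>simp add: multiindex_less\<close>)
    also have "\<dots> = (if I = J then 1 else 0)"
    proof (cases "I = J")
      case False
      then obtain k where "k < d" "I k \<noteq> J k" using PiE_ext[OF PE] by blast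
      then have "(\<Prod>k<d. if J k = I k then 1 else 0 :: 'a) = 0"
        by (intro prod_zero bexI[of _ k]) auto
      then show ?thesis using False by simp
    qed simp
    finally show ?thesis using IJ by simp
  qed (use x y in \<open>auto simp: tensor_idx_def\<close>)
  show "regular_on n G (\<lambda>g. tensor_entry n d g x y)"
  proof (cases x; cases y)
    fix I J assume IJ: "x = Inr I" "y = Inr J"
    then have PE: "I \<in> {..<d} \<rightarrow>\<^sub>E {..<n}" "J \<in> {..<d} \<rightarrow>\<^sub>E {..<n}"
      using x y by (auto simp: tensor_idx_def)
    show ?thesis
    proof (rule regular_on_polyfun[where e = d])
      show "polyfun n (\<lambda>g. \<Prod>k<d. adj_mat g $$ (J k, I k))"
        by (intro polyfun_prod polyfun_adj_mat) (use PE in \<open>auto simp: multiindex_less\<close>)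
      show "G \<subseteq> carrier_mat n n" using Gc GL_carrier_mat by blast
      fix g assume g: "g \<in> G"
      have gm: "g \<in> carrier_mat n n" using Gc[OF g] GL_carrier_mat by blast
      have "tensor_entry n d g x y = (\<Prod>k<d. adj_mat g $$ (J k, I k) / det g)"
        unfolding IJ tensor_entry.simps GL_inv_eq[OF Gc[OF g]]
        by (intro prod.cong refl) (use PE adj_mat(1)[OF gm] in \<open>auto simp: multiindex_less\<close>)
      then show "tensor_entry n d g x y = (\<Prod>k<d. adj_mat g $$ (J k, I k)) / det g ^ d"
        by (simp add: prod_dividef)
    qed
  next
    fix i j assume ij: "x = Inl i" "y = Inl j"
    then have "polyfun n (\<lambda>g :: 'a mat. g $$ (i, j))"
      using x y by (intro polyfun_entry) (auto simp: tensor_idx_def)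
    then show ?thesis
      by (rule regular_on_polyfun[where e = 0]) (use ij Gc GL_carrier_mat in auto)
  qed (use Gc GL_carrier_mat in \<open>auto intro!: regular_on_polyfun[OF polyfun_const[of n 0], where e = 0]\<close>)
  fix g h assume gh: "g \<in> G" "h \<in> G"
  let ?g' = "inv\<^bsub>GL n\<^esub> g" and ?h' = "inv\<^bsub>GL n\<^esub> h"
  have c: "g \<in> carrier_mat n n" "h \<in> carrier_mat n n" "?g' \<in> carrier_mat n n" "?h' \<in> carrier_mat n n"
    using Gc gh GL_carrier_mat GL_inv(1) by blast+
  have inv: "inv\<^bsub>GL n\<^esub> (g * h) = ?h' * ?g'"
    using group.inv_mult_group[OF group_GL Gc[OF gh(1)] Gc[OF gh(2)]] by simp
  show "tensor_entry n d (g * h) x y =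
    (\<Sum>z\<in>tensor_idx n d. tensor_entry n d g x z * tensor_entry n d h z y)"
  proof (cases x; cases y)
    fix I J assume IJ: "x = Inr I" "y = Inr J"
    then have PE: "I \<in> {..<d} \<rightarrow>\<^sub>E {..<n}" "J \<in> {..<d} \<rightarrow>\<^sub>E {..<n}"
      using x y by (auto simp: tensor_idx_def)
    have "tensor_entry n d (g * h) x y = (\<Prod>k<d. \<Sum>c<n. ?h' $$ (J k, c) * ?g' $$ (c, I k))"
      unfolding IJ tensor_entry.simps inv
      by (intro prod.cong refl index_mult_mat_sum[OF c(4,3)]) (use PE in \<open>auto simp: multiindex_less\<close>)
    also have "\<dots> = (\<Sum>K\<in>{..<d} \<rightarrow>\<^sub>E {..<n}. \<Prod>k<d. ?h' $$ (J k, K k) * ?g' $$ (K k, I k))"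
      by (rule prod_sum_multiindex[symmetric])
    finally show ?thesis
      by (simp add: IJ sum_tensor_idx prod.distrib mult.commute)
  next
    fix i j assume ij: "x = Inl i" "y = Inl j"
    then have "i < n" "j < n" using x y by (auto simp: tensor_idx_def)
    then show ?thesis
      by (simp add: ij sum_tensor_idx index_mult_mat_sum[OF c(1,2)] del: index_mult_mat)
  qed (auto simp: sum_tensor_idx)
qed

lemma mpoly_eval_prod:
  fixes f :: "'i \<Rightarrow> ('x, 'a::comm_semiring_1) mpoly"
  shows "mpoly_eval (\<Prod>i\<in>I. f i) x = (\<Prod>i\<in>I. mpoly_eval (f i) x)"
  by (induction I rule: infinite_finite_induct) (simp_all add: mpoly_eval_mult)

lemma polys_in_prod:
  fixes f :: "'i \<Rightarrow> ('x, 'a::comm_semiring_1) mpoly"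
  shows "(\<And>i. i \<in> I \<Longrightarrow> f i \<in> polys_in X) \<Longrightarrow> (\<Prod>i\<in>I. f i) \<in> polys_in X"
  by (induction I rule: infinite_finite_induct) (simp_all add: polys_in_mult, simp_all add: polys_in_def)

lemma polys_in_sum:
  "(\<And>i. i \<in> I \<Longrightarrow> f i \<in> polys_in X) \<Longrightarrow> (\<Sum>i\<in>I. f i) \<in> polys_in X"
  by (induction I rule: infinite_finite_induct) (simp_all add: polys_in_add, simp_all add: polys_in_def)

lemma const_term_eq_eval:
  fixes p :: "('x, 'a::comm_semiring_1) mpoly"
  shows "const_term p = mpoly_eval p (\<lambda>_. 0)"
proof -
  have *: "monom_eval \<mu> (\<lambda>_. 0 :: 'a) = (if \<mu> = 0 then 1 else 0)" for \<mu> :: "'x \<Rightarrow>\<^sub>0 nat"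
  proof (cases "\<mu> = 0")
    case False
    then obtain i where "i \<in> Poly_Mapping.keys \<mu>" by (metis all_not_in_conv keys_eq_empty)
    then show ?thesis using False
      by (auto simp: monom_eval_def in_keys_iff power_0_left intro!: prod_zero bexI[of _ i])
  qed simp
  have "mpoly_eval p (\<lambda>_. 0) = (\<Sum>\<mu>\<in>Poly_Mapping.keys p. if \<mu> = 0 then Poly_Mapping.lookup p 0 else 0)"
    unfolding mpoly_eval_def by (intro sum.cong) (auto simp: *)
  then show ?thesis by (simp add: const_term_def in_keys_iff)
qed

definition mvar :: "'x \<Rightarrow> ('x, 'a::comm_semiring_1) mpoly" where
  "mvar i = Poly_Mapping.single (Poly_Mapping.single i 1) 1"

lemma mpoly_eval_mvar [simp]: "mpoly_eval (mvar i) x = x i"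
  by (simp add: mvar_def mpoly_eval_single monom_eval_def)

lemma mvar_in: "i \<in> X \<Longrightarrow> mvar i \<in> polys_in X"
  by (simp add: mvar_def polys_in_single)

lemma tensor_entry_vec_sum:
  assumes e: "bij_betw e {..<m} (tensor_idx n d)" and i: "i < m" and w: "dim_vec w = m"
  shows "(mat m m (\<lambda>(i, j). tensor_entry n d g (e i) (e j)) *\<^sub>v w) $ i =
    (\<Sum>z\<in>tensor_idx n d. tensor_entry n d g (e i) z * w $ (the_inv_into {..<m} e z))"
proof -
  have inj: "inj_on e {..<m}" using e by (simp add: bij_betw_def)
  have "(mat m m (\<lambda>(i, j). tensor_entry n d g (e i) (e j)) *\<^sub>v w) $ i =
    (\<Sum>j<m. tensor_entry n d g (e i) (e j) * w $ (the_inv_into {..<m} e (e j)))"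
    using i w by (simp add: scalar_prod_def atLeast0LessThan the_inv_into_f_f[OF inj])
  also have "\<dots> = (\<Sum>z\<in>tensor_idx n d. tensor_entry n d g (e i) z * w $ (the_inv_into {..<m} e z))"
    by (rule sum.reindex_bij_betw[OF e])
  finally show ?thesis .
qed

lemma tensor_pairing_invariant:
  fixes G :: "'a::field mat set"
  assumes G: "subgroup G (GL n)" and e: "bij_betw e {..<m} (tensor_idx n d)"
  defines "e' \<equiv> the_inv_into {..<m} e"
  defines "\<rho> \<equiv> (\<lambda>g. mat m m (\<lambda>(i, j). tensor_entry n d g (e i) (e j)))"
  shows "(\<Sum>I\<in>{..<d} \<rightarrow>\<^sub>E {..<n}. mvar (e' (Inr I)) * (\<Prod>k<d. mvar (e' (Inl (I k))))) \<in>
    plus_part (invariants n G m \<rho>)" (is "?F \<in> _")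
proof -
  have inj: "inj_on e {..<m}" and img: "e ` {..<m} = tensor_idx n d"
    using e by (simp_all add: bij_betw_def)
  have e': "e' z < m" "e (e' z) = z" if "z \<in> tensor_idx n d" for z
    using that the_inv_into_into[OF inj, of z "{..<m}"] f_the_inv_into_f[OF inj, of z]
    by (auto simp: e'_def img)
  have Inl_idx: "Inl i \<in> tensor_idx n d" if "i < n" for i using that by (auto simp: tensor_idx_def)
  have Inr_idx: "Inr I \<in> tensor_idx n d" if "I \<in> {..<d} \<rightarrow>\<^sub>E {..<n}" for I
    using that by (auto simp: tensor_idx_def)
  have ev: "mpoly_eval ?F x =
    (\<Sum>I\<in>{..<d} \<rightarrow>\<^sub>E {..<n}. x (e' (Inr I)) * (\<Prod>k<d. x (e' (Inl (I k)))))" for x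
    by (simp add: mpoly_eval_sum mpoly_eval_mult mpoly_eval_prod)
  have "?F \<in> polys_in {..<m}"
    by (intro polys_in_sum polys_in_mult polys_in_prod mvar_in)
      (simp_all add: e' Inl_idx Inr_idx multiindex_less)
  moreover have inv: "mpoly_eval ?F (($) (\<rho> g *\<^sub>v w)) = mpoly_eval ?F (($) w)"
    if g: "g \<in> G" and w: "w \<in> carrier_vec m" for g w
  proof -
    let ?h = "inv\<^bsub>GL n\<^esub> g"
    have gG: "g \<in> carrier (GL n)" using g subgroup.subset[OF G] by blast
    have gm: "g \<in> carrier_mat n n" and hm: "?h \<in> carrier_mat n n"
      using gG GL_inv(1)[OF gG] GL_carrier_mat by blast+
    define x where "x z = w $ (e' z)" for z
    define y where "y z = (\<rho> g *\<^sub>v w) $ (e' z)" for z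
    have y: "y z = (\<Sum>z'\<in>tensor_idx n d. tensor_entry n d g z z' * x z')" if "z \<in> tensor_idx n d" for z
      using tensor_entry_vec_sum[OF e e'(1)[OF that], of w g] w e'(2)[OF that]
      by (simp add: y_def x_def \<rho>_def e'_def)
    have yl: "y (Inl i) = (\<Sum>j<n. g $$ (i, j) * x (Inl j))" if "i < n" for i
      using y[OF Inl_idx[OF that]] by (simp add: sum_tensor_idx)
    have yr: "y (Inr I) = (\<Sum>J\<in>{..<d} \<rightarrow>\<^sub>E {..<n}. (\<Prod>k<d. ?h $$ (J k, I k)) * x (Inr J))"
      if "I \<in> {..<d} \<rightarrow>\<^sub>E {..<n}" for I
      using y[OF Inr_idx[OF that]] by (simp add: sum_tensor_idx)
    have hy: "(\<Sum>i<n. ?h $$ (r, i) * y (Inl i)) = x (Inl r)" if r: "r < n" for r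
    proof -
      have "(\<Sum>i<n. ?h $$ (r, i) * y (Inl i)) =
        (\<Sum>j<n. (\<Sum>i<n. ?h $$ (r, i) * g $$ (i, j)) * x (Inl j))"
        by (simp add: yl sum_distrib_left sum_distrib_right mult.assoc) (rule sum.swap)
      also have "\<dots> = (\<Sum>j<n. if j = r then x (Inl j) else 0)"
        using r by (intro sum.cong refl)
          (auto simp: index_mult_mat_sum[OF hm gm, symmetric] GL_inv(3)[OF gG])
      finally show ?thesis using r by simp
    qed
    have "mpoly_eval ?F (($) (\<rho> g *\<^sub>v w)) =
      (\<Sum>I\<in>{..<d} \<rightarrow>\<^sub>E {..<n}. y (Inr I) * (\<Prod>k<d. y (Inl (I k))))"
      unfolding ev y_def ..
    also have "\<dots> = (\<Sum>I\<in>{..<d} \<rightarrow>\<^sub>E {..<n}. \<Sum>J\<in>{..<d} \<rightarrow>\<^sub>E {..<n}.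
        x (Inr J) * (\<Prod>k<d. ?h $$ (J k, I k) * y (Inl (I k))))"
    proof (rule sum.cong[OF refl])
      fix I assume I: "I \<in> {..<d} \<rightarrow>\<^sub>E {..<n}"
      show "y (Inr I) * (\<Prod>k<d. y (Inl (I k))) = (\<Sum>J\<in>{..<d} \<rightarrow>\<^sub>E {..<n}.
          x (Inr J) * (\<Prod>k<d. ?h $$ (J k, I k) * y (Inl (I k))))"
        unfolding yr[OF I] sum_distrib_right prod.distrib by (intro sum.cong refl) (simp add: mult_ac)
    qed
    also have "\<dots> = (\<Sum>J\<in>{..<d} \<rightarrow>\<^sub>E {..<n}. x (Inr J) *
        (\<Sum>I\<in>{..<d} \<rightarrow>\<^sub>E {..<n}. \<Prod>k<d. ?h $$ (J k, I k) * y (Inl (I k))))"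
      by (subst sum.swap) (simp add: sum_distrib_left)
    also have "\<dots> = (\<Sum>J\<in>{..<d} \<rightarrow>\<^sub>E {..<n}. x (Inr J) * (\<Prod>k<d. x (Inl (J k))))"
    proof (intro sum.cong refl arg_cong2[where f = "(*)"])
      fix J assume J: "J \<in> {..<d} \<rightarrow>\<^sub>E {..<n}"
      have "(\<Sum>I\<in>{..<d} \<rightarrow>\<^sub>E {..<n}. \<Prod>k<d. ?h $$ (J k, I k) * y (Inl (I k))) =
        (\<Prod>k<d. \<Sum>i<n. ?h $$ (J k, i) * y (Inl i))"
        by (rule prod_sum_multiindex)
      also have "\<dots> = (\<Prod>k<d. x (Inl (J k)))"
        by (intro prod.cong refl hy) (use J in \<open>simp add: multiindex_less\<close>)
      finally show "(\<Sum>I\<in>{..<d} \<rightarrow>\<^sub>E {..<n}. \<Prod>k<d. ?h $$ (J k, I k) * y (Inl (I k))) =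
        (\<Prod>k<d. x (Inl (J k)))" .
    qed
    also have "\<dots> = mpoly_eval ?F (($) w)" unfolding ev x_def ..
    finally show ?thesis .
  qed
  moreover have "const_term ?F = 0" by (simp add: const_term_eq_eval ev)
  ultimately show ?thesis
    using subgroup.m_inv_closed[OF G] unfolding plus_part_def invariants_def by auto
qed

lemma weight_neq_1:
  fixes a :: "'a::field"
  assumes "a \<noteq> 0" and no_root: "\<And>j. 0 < j \<Longrightarrow> j \<le> Suc D * D \<Longrightarrow> a ^ j \<noteq> 1"
    and pq: "p + q \<le> D" "p + q \<noteq> 0"
  shows "(1 / a) ^ p * (a ^ Suc D) ^ q \<noteq> 1"
proof
  assume "(1 / a) ^ p * (a ^ Suc D) ^ q = 1"
  then have eq: "a ^ (Suc D * q) = a ^ p"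
    using assms(1) by (simp add: power_mult[symmetric] power_add field_simps)
  show False
  proof (cases "q = 0")
    case True
    have "p \<le> Suc D * D" using pq by simp
    then show False using no_root[of p] eq True pq by simp
  next
    case False
    then have "Suc D * 1 \<le> Suc D * q" by (intro mult_le_mono) auto
    then have lt: "p < Suc D * q" using pq(1) by simp
    have "a ^ (Suc D * q - p) = 1"
      using eq assms(1) lt by (simp add: power_diff)
    moreover have "Suc D * q \<le> Suc D * D" using pq(1) by (intro mult_le_mono) auto
    ultimately show False
      using no_root[of "Suc D * q - p"] lt by (metis diff_le_self le_trans zero_less_diff)
  qed
qed

lemma GL_pow:
  fixes s :: "'a::field mat"
  assumes G: "subgroup G (GL n)" and s: "s \<in> G"
  shows "s ^\<^sub>m k \<in> G"
proof (induction k)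
  case 0
  have "s \<in> carrier_mat n n" using s subgroup.subset[OF G] carrier_GL_subset by blast
  then show ?case using subgroup.one_closed[OF G] by simp
next
  case (Suc k)
  then show ?case using subgroup.m_closed[OF G Suc s] by simp
qed

text \<open>Along the orbit of \<open>(u, l \<otimes> \<dots> \<otimes> l)\<close> under the powers of \<open>inv s\<close> a monomial of bidegree
  \<open>(p, q)\<close> has weight \<open>a\<close> to the power \<open>(D + 1) * q - p\<close>; if \<open>0 < p + q \<le> D\<close>, this exponent
  is nonzero and of absolute value at most \<open>(D + 1) * D\<close>.\<close>

lemma sigma_set_tensor_contradiction:
  fixes G :: "'a::field mat set"
  assumes G: "subgroup G (GL n)" and e: "bij_betw e {..<m} (tensor_idx n (Suc D))"
    and s: "s \<in> G" and ev: "eigenvalue s a"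
    and no_root: "\<And>j. 0 < j \<Longrightarrow> j \<le> Suc D * D \<Longrightarrow> a ^ j \<noteq> 1"
  defines "\<rho> \<equiv> (\<lambda>g. mat m m (\<lambda>(i, j). tensor_entry n (Suc D) g (e i) (e j)))"
  assumes sig: "sigma_set n G m \<rho> (invariants n G m \<rho> \<inter> degree_at_most c)" and c: "c \<le> D"
  shows False
proof -
  let ?d = "Suc D"
  let ?PE = "{..<?d} \<rightarrow>\<^sub>E {..<n}"
  have sG: "s \<in> carrier (GL n)" using s subgroup.subset[OF G] by blast
  have sm: "s \<in> carrier_mat n n" using sG GL_carrier_mat by blast
  obtain u l where u: "u \<in> carrier_vec n" "s *\<^sub>v u = a \<cdot>\<^sub>v u" and lu: "(\<Sum>i<n. l i * u $ i) \<noteq> 0"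
    and l: "\<And>j. j < n \<Longrightarrow> expseq a (\<lambda>k. \<Sum>i<n. l i * (s ^\<^sub>m k) $$ (i, j))"
    using generalized_eigenvector_pairing[OF sm ev] by blast
  have u0: "u \<noteq> 0\<^sub>v n" using lu by auto
  have evec: "eigenvector s u a" using u u0 sm by (auto simp: eigenvector_def)
  have a0: "a \<noteq> 0"
  proof
    assume "a = 0"
    then have "s *\<^sub>v u = 0\<^sub>v n" using u by auto
    then have "(inv\<^bsub>GL n\<^esub> s * s) *\<^sub>v u = 0\<^sub>v n"
      using GL_carrier_mat[OF GL_inv(1)[OF sG]] sm u(1)
      by (simp add: assoc_mult_mat_vec[of _ n n _ n]) (intro eq_vecI, auto)
    then show False using u0 u(1) by (simp add: GL_inv(3)[OF sG])
  qed
  have inj: "inj_on e {..<m}" and img: "e ` {..<m} = tensor_idx n ?d"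
    using e by (simp_all add: bij_betw_def)
  let ?e' = "the_inv_into {..<m} e"
  have e': "?e' z < m" "e (?e' z) = z" if "z \<in> tensor_idx n ?d" for z
    using that the_inv_into_into[OF inj, of z "{..<m}"] f_the_inv_into_f[OF inj, of z]
    by (auto simp: img)
  have Inl_idx: "Inl i \<in> tensor_idx n ?d" if "i < n" for i using that by (auto simp: tensor_idx_def)
  have Inr_idx: "Inr I \<in> tensor_idx n ?d" if "I \<in> ?PE" for I
    using that by (auto simp: tensor_idx_def)
  define w where "w = case_sum (\<lambda>i. u $ i) (\<lambda>I. \<Prod>k<?d. l (I k))"
  define v where "v = vec m (\<lambda>i. w (e i))"
  have v: "v \<in> carrier_vec m" by (simp add: v_def)
  have vw: "v $ ?e' z = w z" if "z \<in> tensor_idx n ?d" for z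
    using e'[OF that] by (simp add: v_def)
  define y where "y k i = (\<rho> (inv\<^bsub>GL n\<^esub> (s ^\<^sub>m k)) *\<^sub>v v) $ i" for k i
  define wt where "wt i = (case e i of Inl _ \<Rightarrow> 1 / a | Inr _ \<Rightarrow> a ^ ?d)" for i
  have yexp: "expseq (wt i) (\<lambda>k. y k i)" if i: "i < m" for i
  proof -
    have sk: "s ^\<^sub>m k \<in> carrier (GL n)" for k
      using GL_pow[OF G s] subgroup.subset[OF G] by blast
    have inv_inv: "inv\<^bsub>GL n\<^esub> (inv\<^bsub>GL n\<^esub> (s ^\<^sub>m k)) = s ^\<^sub>m k" for k
      by (rule group.inv_inv[OF group_GL sk])
    have y: "y k i = (\<Sum>z\<in>tensor_idx n ?d. tensor_entry n ?d (inv\<^bsub>GL n\<^esub> (s ^\<^sub>m k)) (e i) z * w z)" for k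
      unfolding y_def \<rho>_def using tensor_entry_vec_sum[OF e i, of v "inv\<^bsub>GL n\<^esub> (s ^\<^sub>m k)"] v
      by (simp add: vw)
    have ei: "e i \<in> tensor_idx n ?d" using i img by auto
    show ?thesis
    proof (cases "e i")
      case (Inl r)
      then have r: "r < n" using ei by (auto simp: tensor_idx_def)
      have "y k i = (1 / a) ^ k * u $ r" for k
      proof -
        let ?t = "inv\<^bsub>GL n\<^esub> (s ^\<^sub>m k)"
        have tm: "?t \<in> carrier_mat n n" using GL_inv(1)[OF sk] GL_carrier_mat by blast
        have "u = (?t * s ^\<^sub>m k) *\<^sub>v u" using u(1) by (simp add: GL_inv(3)[OF sk])
        also have "\<dots> = ?t *\<^sub>v (s ^\<^sub>m k *\<^sub>v u)"
          using tm sm u(1) by (intro assoc_mult_mat_vec) auto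
        also have "s ^\<^sub>m k *\<^sub>v u = a ^ k \<cdot>\<^sub>v u" by (rule eigenvector_pow[OF sm evec])
        also have "?t *\<^sub>v (a ^ k \<cdot>\<^sub>v u) = a ^ k \<cdot>\<^sub>v (?t *\<^sub>v u)"
          using tm u(1) by (rule mult_mat_vec)
        finally have "u $ r = a ^ k * (?t *\<^sub>v u) $ r"
          using tm r by (metis carrier_matD(1) dim_mult_mat_vec index_smult_vec(1))
        moreover have "y k i = (?t *\<^sub>v u) $ r"
          using Inl r tm u(1) by (simp add: y sum_tensor_idx w_def scalar_prod_def atLeast0LessThan)
        ultimately show ?thesis using a0 by (simp add: power_one_over)
      qed
      then show ?thesis
        using expseq_mult[OF expseq_power expseq_const, of "1 / a" "u $ r"] Inl by (simp add: wt_def)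
    next
      case (Inr I)
      then have I: "I \<in> ?PE" using ei by (auto simp: tensor_idx_def)
      have "y k i = (\<Prod>c<?d. \<Sum>j<n. l j * (s ^\<^sub>m k) $$ (j, I c))" for k
      proof -
        have "y k i = (\<Sum>J\<in>?PE. \<Prod>c<?d. l (J c) * (s ^\<^sub>m k) $$ (J c, I c))"
          by (simp add: y Inr sum_tensor_idx inv_inv w_def prod.distrib mult.commute del: prod.lessThan_Suc)
        also have "\<dots> = (\<Prod>c<?d. \<Sum>j<n. l j * (s ^\<^sub>m k) $$ (j, I c))"
          by (rule prod_sum_multiindex)
        finally show ?thesis .
      qed
      moreover have "expseq (\<Prod>c<?d. a) (\<lambda>k. \<Prod>c<?d. \<Sum>j<n. l j * (s ^\<^sub>m k) $$ (j, I c))"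
        by (intro expseq_prod l) (use I in \<open>simp add: multiindex_less\<close>)
      ultimately show ?thesis using Inr by (simp add: wt_def del: prod.lessThan_Suc)
    qed
  qed
  have vanish: "mpoly_eval f (($) v) = 0"
    if f: "f \<in> plus_part (invariants n G m \<rho> \<inter> degree_at_most c)" for f
  proof (rule sum_expseq_constant)
    have fp: "f \<in> polys_in {..<m}" and f0: "Poly_Mapping.lookup f 0 = 0"
      and fd: "f \<in> degree_at_most c"
      and fi: "\<And>g. g \<in> G \<Longrightarrow> mpoly_eval f (($) (\<rho> (inv\<^bsub>GL n\<^esub> g) *\<^sub>v v)) = mpoly_eval f (($) v)"
      using f v by (auto simp: plus_part_def invariants_def const_term_def)
    let ?W = "\<lambda>\<mu>. \<Prod>i\<in>Poly_Mapping.keys \<mu>. wt i ^ Poly_Mapping.lookup \<mu> i"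
    show "(\<Sum>\<mu>\<in>Poly_Mapping.keys f. Poly_Mapping.lookup f \<mu> * monom_eval \<mu> (y k)) =
        mpoly_eval f (($) v)" for k
      using fi[OF GL_pow[OF G s, of k]] by (simp add: mpoly_eval_def y_def[abs_def])
    fix \<mu> assume \<mu>: "\<mu> \<in> Poly_Mapping.keys f"
    then have \<mu>m: "Poly_Mapping.keys \<mu> \<subseteq> {..<m}" using fp by (auto simp: polys_in_def)
    have "expseq (?W \<mu>) (\<lambda>k. monom_eval \<mu> (y k))"
      unfolding monom_eval_def by (intro expseq_prod expseq_pow yexp) (use \<mu>m in auto)
    from expseq_mult[OF expseq_const this]
    show "expseq (?W \<mu>) (\<lambda>k. Poly_Mapping.lookup f \<mu> * monom_eval \<mu> (y k))" by simp
    let ?L = "{i \<in> Poly_Mapping.keys \<mu>. isl (e i)}" and ?R = "{i \<in> Poly_Mapping.keys \<mu>. \<not> isl (e i)}"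
    let ?p = "\<Sum>i\<in>?L. Poly_Mapping.lookup \<mu> i" and ?q = "\<Sum>i\<in>?R. Poly_Mapping.lookup \<mu> i"
    have LR: "Poly_Mapping.keys \<mu> = ?L \<union> ?R" "?L \<inter> ?R = {}" "finite ?L" "finite ?R" by auto
    have "?W \<mu> = (\<Prod>i\<in>?L. wt i ^ Poly_Mapping.lookup \<mu> i) * (\<Prod>i\<in>?R. wt i ^ Poly_Mapping.lookup \<mu> i)"
      by (subst LR(1)) (rule prod.union_disjoint[OF LR(3,4,2)])
    also have "(\<Prod>i\<in>?L. wt i ^ Poly_Mapping.lookup \<mu> i) = (1 / a) ^ ?p"
      unfolding power_sum by (intro prod.cong refl) (auto simp: wt_def split: sum.split)
    also have "(\<Prod>i\<in>?R. wt i ^ Poly_Mapping.lookup \<mu> i) = (a ^ ?d) ^ ?q"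
      unfolding power_sum by (intro prod.cong refl) (auto simp: wt_def split: sum.split)
    finally have W: "?W \<mu> = (1 / a) ^ ?p * (a ^ ?d) ^ ?q" .
    have deg: "?p + ?q = monom_degree \<mu>"
      unfolding monom_degree_def by (subst (3) LR(1)) (rule sum.union_disjoint[OF LR(3,4,2), symmetric])
    have "monom_degree \<mu> \<le> D" using \<mu> fd c by (force simp: degree_at_most_def)
    moreover have "monom_degree \<mu> \<noteq> 0"
    proof
      assume "monom_degree \<mu> = 0"
      then have "\<mu> = 0" by (auto simp: monom_degree_def in_keys_iff intro!: poly_mapping_eqI)
      then show False using \<mu> f0 by (simp add: in_keys_iff)
    qed
    ultimately show "?W \<mu> \<noteq> 1"
      unfolding W deg[symmetric] by (intro weight_neq_1[OF a0]) (rule no_root)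
  qed
  let ?F = "\<Sum>I\<in>?PE. mvar (?e' (Inr I)) * (\<Prod>k<?d. mvar (?e' (Inl (I k))))"
  have "mpoly_eval ?F (($) v) = (\<Sum>I\<in>?PE. \<Prod>k<?d. l (I k) * u $ I k)"
    unfolding mpoly_eval_sum mpoly_eval_mult mpoly_eval_prod mpoly_eval_mvar prod.distrib
    by (intro sum.cong arg_cong2[where f = "(*)"] prod.cong refl)
      (simp_all add: vw Inl_idx Inr_idx multiindex_less w_def)
  also have "\<dots> = (\<Prod>k<?d. \<Sum>i<n. l i * u $ i)" by (rule prod_sum_multiindex)
  also have "\<dots> \<noteq> 0" using lu by simp
  finally have "v \<notin> nullcone n G m \<rho>"
    using tensor_pairing_invariant[OF G e] unfolding nullcone_def \<rho>_def by blast
  then show False using sig v vanish unfolding sigma_set_def by blast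
qed

lemma finite_sigma_group_bound:
  assumes "sigma_group n G < \<infinity>"
  obtains D where "\<And>m \<rho>. rational_rep n G m \<rho> \<Longrightarrow>
    \<exists>c\<le>D. sigma_set n G m \<rho> (invariants n G m \<rho> \<inter> degree_at_most c)"
proof -
  obtain D where D: "sigma_group n G = enat D" using assms by (cases "sigma_group n G") auto
  have "\<exists>c\<le>D. sigma_set n G m \<rho> (invariants n G m \<rho> \<inter> degree_at_most c)"
    if "rational_rep n G m \<rho>" for m \<rho>
  proof -
    have "sigma_rep n G m \<rho> \<le> enat D"
      unfolding D[symmetric] sigma_group_def by (rule Sup_upper) (use that in blast)
    also have "enat D < enat (Suc D)" by simp
    finally show ?thesis unfolding sigma_rep_def Inf_less_iff by (auto simp: less_Suc_eq_le)
  qed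
  then show thesis using that by blast
qed

lemma finite_sigma_group_eigenvalues:
  fixes G :: "'a::field mat set"
  assumes G: "subgroup G (GL n)" and "sigma_group n G < \<infinity>"
  obtains N where "\<And>s a. s \<in> G \<Longrightarrow> eigenvalue s a \<Longrightarrow> \<exists>j. 0 < j \<and> j \<le> N \<and> a ^ j = 1"
proof -
  obtain D where D: "\<And>m \<rho>. rational_rep n G m \<rho> \<Longrightarrow>
    \<exists>c\<le>D. sigma_set n G m \<rho> (invariants n G m \<rho> \<inter> degree_at_most c)"
    using finite_sigma_group_bound[OF assms(2)] by blast
  obtain e where e: "bij_betw e {..<card (tensor_idx n (Suc D))} (tensor_idx n (Suc D))"
    using ex_bij_betw_nat_finite[OF finite_tensor_idx] by (auto simp: atLeast0LessThan)
  show thesis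
  proof (rule that[of "Suc D * D"], rule ccontr)
    fix s a assume s: "s \<in> G" "eigenvalue s a" and "\<not> (\<exists>j. 0 < j \<and> j \<le> Suc D * D \<and> a ^ j = 1)"
    then have "\<And>j. 0 < j \<Longrightarrow> j \<le> Suc D * D \<Longrightarrow> a ^ j \<noteq> 1" by blast
    from sigma_set_tensor_contradiction[OF G e s this] D[OF rational_rep_tensor[OF G e]]
    show False by blast
  qed
qed

section \<open>The identity component\<close>

lemma polyfun_char_poly: "polyfun n (\<lambda>A. poly (char_poly A) c)"
proof -
  have "polyfun n (\<lambda>A. det (- char_matrix A c))"
  proof (rule polyfun_det)
    fix i j assume ij: "i < n" "j < n"
    then have "polyfun n (\<lambda>A. (if i = j then c else 0) - A $$ (i, j))"
      by (intro polyfun_diff polyfun_const polyfun_entry)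
    then show "polyfun n (\<lambda>A. (- char_matrix A c) $$ (i, j))"
      by (subst polyfun_cong) (use ij in \<open>auto simp: char_matrix_def\<close>)
  qed (simp add: char_matrix_def)
  then show ?thesis by (subst polyfun_cong) (simp_all add: char_poly_matrix)
qed

lemma finite_roots_of_unity_le: "finite {a :: 'a::idom. \<exists>j. 0 < j \<and> j \<le> N \<and> a ^ j = 1}"
proof -
  have "{a :: 'a. \<exists>j. 0 < j \<and> j \<le> N \<and> a ^ j = 1} \<subseteq> (\<Union>j\<in>{1..N}. {a. poly (monom 1 j - 1) a = 0})"
    by (auto simp: poly_monom Bex_def Suc_le_eq)
  moreover have "finite {a :: 'a. poly (monom 1 j - 1) a = 0}" if "j \<in> {1..N}" for j
  proof (rule poly_roots_finite)
    have "coeff (monom 1 j - 1 :: 'a poly) j = 1" using that by simp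
    then show "monom 1 j - 1 \<noteq> (0 :: 'a poly)" by (metis coeff_0 zero_neq_one)
  qed
  ultimately show ?thesis by (meson finite_UN_I finite_atLeastAtMost finite_subset)
qed

lemma unipotent_identity_component:
  fixes G :: "'a::alg_closed_field mat set"
  assumes G: "subgroup G (GL n)"
    and N: "\<And>s a. s \<in> G \<Longrightarrow> eigenvalue s a \<Longrightarrow> \<exists>j. 0 < j \<and> j \<le> N \<and> a ^ j = 1"
  shows "unipotent n (identity_component n G)"
proof -
  let ?T = "subtopology (zariski n) G" and ?C = "identity_component n G"
  have Gc: "G \<subseteq> carrier_mat n n" using subgroup.subset[OF G] carrier_GL_subset by blast
  then have top: "topspace ?T = G" by auto
  have conn: "connectedin (zariski n) ?C" and CG: "?C \<subseteq> G"
    using connectedin_connected_component_of[of ?T "1\<^sub>m n"]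
    by (simp_all add: identity_component_def connectedin_subtopology)
  have one: "1\<^sub>m n \<in> ?C"
    using subgroup.one_closed[OF G] by (simp add: identity_component_def connected_component_of_refl top del: topspace_subtopology)
  define R where "R = {a :: 'a. \<exists>j. 0 < j \<and> j \<le> N \<and> a ^ j = 1}"
  have R: "finite R" unfolding R_def by (rule finite_roots_of_unity_le)
  have "finite ((\<lambda>A. poly (char_poly A) c) ` ?C)" for c
  proof (rule finite_subset)
    show "finite ((\<lambda>es. poly (\<Prod>e\<leftarrow>es. [:- e, 1:]) c) ` {es. set es \<subseteq> R \<and> length es = n})"
      using R by (intro finite_imageI finite_lists_length_eq)
    show "(\<lambda>A. poly (char_poly A) c) ` ?C \<subseteq>
        (\<lambda>es. poly (\<Prod>e\<leftarrow>es. [:- e, 1:]) c) ` {es. set es \<subseteq> R \<and> length es = n}"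
    proof (rule image_subsetI)
      fix A assume "A \<in> ?C"
      then have A: "A \<in> G" "A \<in> carrier_mat n n" using CG Gc by blast+
      obtain es where es: "length es = n" "char_poly A = (\<Prod>e\<leftarrow>es. [:- e, 1:])"
        "\<And>e. e \<in> set es \<Longrightarrow> eigenvalue A e" using char_poly_splits[OF A(2)] by metis
      then have "es \<in> {es. set es \<subseteq> R \<and> length es = n}" using N[OF A(1)] by (auto simp: R_def)
      then show "poly (char_poly A) c \<in>
        (\<lambda>es. poly (\<Prod>e\<leftarrow>es. [:- e, 1:]) c) ` {es. set es \<subseteq> R \<and> length es = n}"
        unfolding es(2) by (rule imageI)
    qed
  qed
  note const = polyfun_constant_on_connected[OF conn polyfun_char_poly this]
  have "a = 1" if A: "A \<in> ?C" and a: "eigenvalue A a" for A a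
  proof -
    have Am: "A \<in> carrier_mat n n" using A CG Gc by blast
    have "poly (char_poly (1\<^sub>m n)) a = poly (char_poly A) a" by (rule const[OF one A])
    also have "\<dots> = 0" using a by (simp add: eigenvalue_root_char_poly[OF Am])
    finally have "eigenvalue (1\<^sub>m n) a" by (simp add: eigenvalue_root_char_poly[OF one_carrier_mat])
    then obtain v where v: "v \<in> carrier_vec n" "v \<noteq> 0\<^sub>v n" "v = a \<cdot>\<^sub>v v"
      by (auto simp: eigenvalue_def eigenvector_def)
    then obtain i where "i < n" "v $ i \<noteq> 0"
      by (metis carrier_vecD eq_vecI index_zero_vec(1) index_zero_vec(2))
    moreover have "v $ i = a * v $ i"
      using v(1,3) \<open>i < n\<close> by (metis carrier_vecD index_smult_vec(1))
    ultimately show "a = 1" by simp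
  qed
  then show ?thesis
    unfolding unipotent_def using unipotent_of_eigenvalues CG Gc by blast
qed

theorem corollary4p3:
  fixes G :: "'a::alg_closed_field mat set" and n :: nat
  assumes "linear_algebraic_group n G"
    and "sigma_group n G < \<infinity>"
  shows "unipotent n (identity_component n G) \<and>
    (finite G \<or>
     (infinite (identity_component n G) \<and> unipotent n (identity_component n G)))"
proof -
  have G: "subgroup G (GL n)" using assms(1) by (simp add: linear_algebraic_group_def)
  obtain N where "\<And>s a. s \<in> G \<Longrightarrow> eigenvalue s a \<Longrightarrow> \<exists>j. 0 < j \<and> j \<le> N \<and> a ^ j = 1"
    using finite_sigma_group_eigenvalues[OF G assms(2)] by blast
  then show ?thesis
    using unipotent_identity_component[OF G] infinite_identity_component[OF G] by blast
qed

end
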